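(* Let $q=2^{2n+1}\geq 8$ (with $n\geq 1$ an integer), let $G=\mathsf{Sz}(q)$ be the Suzuki group acting on the Suzuki-Tits ovoid $\mathcal{P}=\{p(\alpha,\beta)\mid \alpha,\beta\in\mathbb{F}\}\cup\{\infty\}$, where $\mathbb{F}=\mathrm{GF}(q)$, and let $\Delta_2=\{p(0,\beta)\mid \beta\in\mathbb{F}\}$ and $\Delta_3=\{p(\alpha,\beta)\mid \alpha\in\mathbb{F}^{\times},\ \beta\in\mathbb{F}\}$. Then: (a) if $\mathcal{B}_2=\Delta_2^{G}$, then $(\mathcal{P},\mathcal{B}_2)$ is a $2$-design with parameters $(v,k,\lambda)=(q^{2}+1,\,q,\,q-1)$ and replication number $q^{2}$; (b) if $\mathcal{B}_3=\Delta_3^{G}$, then $(\mathcal{P},\mathcal{B}_3)$ is a $2$-design with parameters $(v,k,\lambda)=(q^{2}+1,\,q(q-1),\,(q-1)(q^{2}-q-1))$ and replication number $q^{2}(q-1)$. Moreover, for each $i\in\{2,3\}$, $G=\mathsf{Sz}(q)$ is a flag-transitive automorphism group of the design $(\mathcal{P},\mathcal{B}_i)$, acting primitively on the point set $\mathcal{P}$ but imprimitively on the block set $\mathcal{B}_i$.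
   Context: Field. $\mathbb{F}=\mathrm{GF}(q)$ is the finite field with $q=2^{2n+1}\geq 8$ elements, and $\theta$ is the automorphism $\alpha\mapsto\alpha^{2^{n+1}}$ of $\mathbb{F}$, so that $\theta^2$ is the Frobenius automorphism $\alpha\mapsto\alpha^2$. Exponents involving $\theta$ are read as $x^{\theta}=\theta(x)$, $x^{1+\theta}=x\,\theta(x)$, $x^{2+\theta}=x^2\theta(x)$. Suzuki group. Let $e$ be the $4\times4$ identity matrix and $e_{ij}$ the $4\times 4$ matrix with $1$ in entry $(i,j)$ and $0$ elsewhere. For $x,y\in\mathbb{F}$ and $\kappa\in\mathbb{F}^{\times}$ put $$s(x,y)=e+xe_{21}+ye_{31}+x^{\theta}e_{32}+(x^{2+\theta}+xy+y^{\theta})e_{41}+(x^{1+\theta}+y)e_{42}+xe_{43},$$ $$m(\kappa)=\kappa^{1+2^{n}}e_{11}+\kappa^{2^{n}}e_{22}+\kappa^{-2^{n}}e_{33}+\kappa^{-1-2^{n}}e_{44},\qquad \tau=e_{14}+e_{23}+e_{32}+e_{41}.$$ The Suzuki group $\mathsf{Sz}(q)$ is the subgroup of $\mathsf{GL}_4(q)$ generated by all $s(x,y)$, all $m(\kappa)$, and $\tau$. Ovoid and action. $G=\mathsf{Sz}(q)$ acts on the right on the projective space $\mathsf{PG}_3(q)$ of $1$-dimensional spaces $[w]$ of row vectors $w\in\mathbb{F}^4$ by $[w]^{x}=[wx]$. Put $p(\alpha,\beta)=[\alpha^{2+\theta}+\alpha\beta+\beta^{\theta},\,\beta,\,\alpha,\,1]$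 and $\infty=[1,0,0,0]$. The Suzuki-Tits ovoid $\mathcal{P}=\{p(\alpha,\beta)\mid\alpha,\beta\in\mathbb{F}\}\cup\{\infty\}$ has $q^2+1$ points and is preserved by $G$, which acts on it as a doubly transitive permutation group. Designs. A $2$-design with parameters $(v,k,\lambda)$ is a pair $(\mathcal{P},\mathcal{B})$ with $\mathcal{P}$ a set of $v$ points and $\mathcal{B}$ a set of blocks such that each block is a $k$-subset of $\mathcal{P}$ and any two distinct points are contained in exactly $\lambda$ blocks. With $b=|\mathcal{B}|$, the replication number is $bk/v$, the constant number of blocks containing a given point. For $\Delta\subseteq\mathcal{P}$, $\Delta^{G}=\{\Delta^{x}\mid x\in G\}$ (a set of subsets of $\mathcal{P}$, without repetition), where $\Delta^x=\{\omega^x\mid\omega\in\Delta\}$. An automorphism group of a design is a group of permutations of the points that maps blocks to blocks (not necessarily the full automorphism group); it is flag-transitive if it is transitive on the pairs $(\omega,B)$ with $\omega\in\mathcal{P}$, $B\in\mathcal{B}$, $\omega\in B$. A transitive action is primitive if it preserves no nontrivial partition, and imprimitive otherwise. *)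

theory Defs
  imports
    "HOL-Analysis.Analysis"
    "HOL-Algebra.Group_Action"
    "HOL-Algebra.Generated_Groups"
    "HOL-Library.Disjoint_Sets"
begin

section \<open>Group actions\<close>

text \<open>
  The library's \<^locale>\<open>group_action\<close> is a left action. A right action of \<open>G\<close> is the
  same thing as a left action of the opposite group, which has the same carrier and inverses.
\<close>

definition opposite_group :: "('a, 'b) monoid_scheme \<Rightarrow> ('a, 'b) monoid_scheme" where
  "opposite_group G = G\<lparr>monoid.mult := (\<lambda>x y. y \<otimes>\<^bsub>G\<^esub> x)\<rparr>"

definition trivial_partition :: "'p set \<Rightarrow> 'p set set \<Rightarrow> bool" where
  "trivial_partition E \<C> \<longleftrightarrow> \<C> = {E} \<or> \<C> = (\<lambda>\<omega>. {\<omega>}) ` E"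

definition preserves_partition ::
    "('g, 'm) monoid_scheme \<Rightarrow> ('g \<Rightarrow> 'p \<Rightarrow> 'p) \<Rightarrow> 'p set set \<Rightarrow> bool" where
  "preserves_partition G \<phi> \<C> \<longleftrightarrow> (\<forall>x\<in>carrier G. \<forall>C\<in>\<C>. \<phi> x ` C \<in> \<C>)"

definition primitive_action ::
    "('g, 'm) monoid_scheme \<Rightarrow> 'p set \<Rightarrow> ('g \<Rightarrow> 'p \<Rightarrow> 'p) \<Rightarrow> bool" where
  "primitive_action G E \<phi> \<longleftrightarrow> transitive_action G E \<phi> \<and>
     (\<forall>\<C>. partition_on E \<C> \<and> preserves_partition G \<phi> \<C> \<longrightarrow> trivial_partition E \<C>)"

definition imprimitive_action ::
    "('g, 'm) monoid_scheme \<Rightarrow> 'p set \<Rightarrow> ('g \<Rightarrow> 'p \<Rightarrow> 'p) \<Rightarrow> bool" where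
  "imprimitive_action G E \<phi> \<longleftrightarrow> transitive_action G E \<phi> \<and> \<not> primitive_action G E \<phi>"


section \<open>Designs and their automorphism groups\<close>

definition two_design :: "'p set \<Rightarrow> 'p set set \<Rightarrow> nat \<Rightarrow> nat \<Rightarrow> nat \<Rightarrow> bool" where
  "two_design P \<B> v k l \<longleftrightarrow>
     finite P \<and> card P = v \<and>
     (\<forall>B\<in>\<B>. B \<subseteq> P \<and> card B = k) \<and>
     (\<forall>\<omega>\<in>P. \<forall>\<omega>'\<in>P. \<omega> \<noteq> \<omega>' \<longrightarrow> card {B\<in>\<B>. \<omega> \<in> B \<and> \<omega>' \<in> B} = l)"

text \<open>
  For a design with \<open>v\<close> points and block size \<open>k\<close>: \<open>r = b k / v\<close> (an exact quotient,
  hence in \<^typ>\<open>rat\<close>), and this is the number of blocks on each point.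
\<close>

definition has_replication_number ::
    "'p set \<Rightarrow> 'p set set \<Rightarrow> nat \<Rightarrow> nat \<Rightarrow> bool" where
  "has_replication_number P \<B> k r \<longleftrightarrow>
     (of_nat (card \<B> * k) / of_nat (card P) :: rat) = of_nat r \<and>
     (\<forall>\<omega>\<in>P. card {B\<in>\<B>. \<omega> \<in> B} = r)"

definition flags :: "'p set \<Rightarrow> 'p set set \<Rightarrow> ('p \<times> 'p set) set" where
  "flags P \<B> = {(\<omega>, B). \<omega> \<in> P \<and> B \<in> \<B> \<and> \<omega> \<in> B}"

text \<open>The action is required to be faithful, so that \<open>G\<close> is a group of permutations of \<open>P\<close>.\<close>

definition design_automorphism_group ::
    "('g, 'm) monoid_scheme \<Rightarrow> ('g \<Rightarrow> 'p \<Rightarrow> 'p) \<Rightarrow> 'p set \<Rightarrow> 'p set set \<Rightarrow> bool" where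
  "design_automorphism_group G \<phi> P \<B> \<longleftrightarrow>
     faithful_action G P \<phi> \<and> (\<forall>x\<in>carrier G. \<forall>B\<in>\<B>. \<phi> x ` B \<in> \<B>)"

definition flag_transitive ::
    "('g, 'm) monoid_scheme \<Rightarrow> ('g \<Rightarrow> 'p \<Rightarrow> 'p) \<Rightarrow> 'p set \<Rightarrow> 'p set set \<Rightarrow> bool" where
  "flag_transitive G \<phi> P \<B> \<longleftrightarrow>
     (\<forall>(\<omega>, B)\<in>flags P \<B>. \<forall>(\<omega>', B')\<in>flags P \<B>. \<exists>x\<in>carrier G. \<phi> x \<omega> = \<omega>' \<and> \<phi> x ` B = B')"

definition block_action :: "('g \<Rightarrow> 'p \<Rightarrow> 'p) \<Rightarrow> 'p set set \<Rightarrow> 'g \<Rightarrow> 'p set \<Rightarrow> 'p set" where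
  "block_action \<phi> \<B> x = (\<lambda>B\<in>\<B>. \<phi> x ` B)"


section \<open>The Suzuki group\<close>

text \<open>
  Throughout, \<open>'f\<close> is intended to be a field with \<open>2 ^ (2 * n + 1)\<close> elements.
  Rows and columns are indexed by the type \<^typ>\<open>4\<close>, in which \<open>4 = 0\<close>, so \<open>1, 2, 3, 4\<close> are its
  four distinct elements.
\<close>

definition theta :: "nat \<Rightarrow> 'f::field \<Rightarrow> 'f" where
  "theta n x = x ^ (2 ^ (n + 1))"

text \<open>The matrix \<open>a e\<^sub>i\<^sub>j\<close>.\<close>

definition elem_mat :: "4 \<Rightarrow> 4 \<Rightarrow> 'f::field \<Rightarrow> 'f^4^4" where
  "elem_mat i j a = (\<chi> k l. if k = i \<and> l = j then a else 0)"

definition Sz_s :: "nat \<Rightarrow> 'f::field \<Rightarrow> 'f \<Rightarrow> 'f^4^4" where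
  "Sz_s n x y =
     mat 1 + elem_mat 2 1 x + elem_mat 3 1 y + elem_mat 3 2 (theta n x)
       + elem_mat 4 1 (x^2 * theta n x + x * y + theta n y)
       + elem_mat 4 2 (x * theta n x + y)
       + elem_mat 4 3 x"

definition Sz_m :: "nat \<Rightarrow> 'f::field \<Rightarrow> 'f^4^4" where
  "Sz_m n \<kappa> =
     elem_mat 1 1 (\<kappa> powi (1 + 2 ^ n)) + elem_mat 2 2 (\<kappa> powi (2 ^ n))
       + elem_mat 3 3 (\<kappa> powi (- (2 ^ n))) + elem_mat 4 4 (\<kappa> powi (- 1 - 2 ^ n))"

definition Sz_tau :: "'f::field^4^4" where
  "Sz_tau = elem_mat 1 4 1 + elem_mat 2 3 1 + elem_mat 3 2 1 + elem_mat 4 1 1"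

definition GL4 :: "('f::field^4^4) monoid" where
  "GL4 = \<lparr>carrier = {A. invertible A}, monoid.mult = (**), one = mat 1\<rparr>"

definition Sz :: "nat \<Rightarrow> ('f::field^4^4) monoid" where
  "Sz n = GL4\<lparr>carrier := generate GL4
     ({Sz_s n x y | x y. True} \<union> {Sz_m n \<kappa> | \<kappa>. \<kappa> \<noteq> 0} \<union> {Sz_tau})\<rparr>"


section \<open>The Suzuki-Tits ovoid\<close>

text \<open>Projective points are one-dimensional subspaces, as sets of row vectors.\<close>

definition proj_point :: "'f::field^4 \<Rightarrow> ('f^4) set" where
  "proj_point w = vec.span {w}"

definition ovoid_point :: "nat \<Rightarrow> 'f::field \<Rightarrow> 'f \<Rightarrow> ('f^4) set" where
  "ovoid_point n \<alpha> \<beta> =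
     proj_point (vector [\<alpha>^2 * theta n \<alpha> + \<alpha> * \<beta> + theta n \<beta>, \<beta>, \<alpha>, 1])"

definition ovoid_infinity :: "('f::field^4) set" where
  "ovoid_infinity = proj_point (vector [1, 0, 0, 0])"

definition ovoid :: "nat \<Rightarrow> ('f::field^4) set set" where
  "ovoid n = {ovoid_point n \<alpha> \<beta> | \<alpha> \<beta>. True} \<union> {ovoid_infinity}"

definition proj_image :: "'f::field^4^4 \<Rightarrow> ('f^4) set \<Rightarrow> ('f^4) set" where
  "proj_image x U = (\<lambda>w. w v* x) ` U"

text \<open>Restricted to the ovoid because the library's permutations of a set are extensional.\<close>

definition ovoid_action :: "nat \<Rightarrow> 'f::field^4^4 \<Rightarrow> ('f^4) set \<Rightarrow> ('f^4) set" where
  "ovoid_action n x = (\<lambda>\<omega>\<in>ovoid n. proj_image x \<omega>)"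

definition Delta2 :: "nat \<Rightarrow> ('f::field^4) set set" where
  "Delta2 n = {ovoid_point n 0 \<beta> | \<beta>. True}"

definition Delta3 :: "nat \<Rightarrow> ('f::field^4) set set" where
  "Delta3 n = {ovoid_point n \<alpha> \<beta> | \<alpha> \<beta>. \<alpha> \<noteq> 0}"

definition set_orbit :: "nat \<Rightarrow> ('f::field^4) set set \<Rightarrow> ('f^4) set set set" where
  "set_orbit n \<Delta> = orbit (Sz n) (\<lambda>x. (`) (proj_image x)) \<Delta>"

end

theory Submission
  imports Defs
begin

text \<open>
  The relation \<open>\<tau> s(x,y) \<tau> = s' m' \<tau> s''\<close> gives the Bruhat decomposition of the Suzuki group, so the
  stabiliser of \<open>\<infinity>\<close> consists of the matrices \<open>m(\<kappa>) s(x,y)\<close>; it permutes the \<open>q\<close> classes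
  \<open>{p(c,\<beta>) | \<beta>}\<close>. Since \<open>\<tau>\<close> maps no class to a class, and no circle (a class together with \<open>\<infinity>\<close>) to a
  circle, the set stabilisers of \<open>\<Delta>\<^sub>2\<close> and of \<open>\<Delta>\<^sub>3\<close> fix \<open>\<infinity>\<close>. Hence each block has a distinguished
  point, and the blocks sharing it form a block of imprimitivity of size \<open>q\<close>; in particular there
  are \<open>q(q\<^sup>2 + 1)\<close> blocks. As the action is doubly transitive, \<open>\<lambda>\<close> and the replication number then
  follow by double counting.
\<close>

section \<open>Finite fields of order an odd power of two\<close>

text \<open>Multiplication by a nonzero \<open>x\<close> permutes the nonzero elements, so their
  product absorbs a factor \<open>x ^ (q - 1)\<close>, which must therefore be 1.\<close>

lemma finite_field_power_card:
  fixes x :: "'f::{field,finite}"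
  shows "x ^ CARD('f) = x"
proof (cases "x = 0")
  case False
  have "(\<Prod>y\<in>-{0}. y) = (\<Prod>y\<in>-{0}. x * y)"
    by (rule prod.reindex_bij_witness[of _ "\<lambda>y. x * y" "\<lambda>y. y / x"]) (use False in auto)
  also have "\<dots> = x ^ card (-{0::'f}) * (\<Prod>y\<in>-{0}. y)"
    by (simp add: prod.distrib)
  finally have "x ^ card (-{0::'f}) = 1"
    by simp
  moreover have "CARD('f) = Suc (card (-{0::'f}))"
    by (simp add: Compl_eq_Diff_UNIV card_Diff_singleton Suc_diff_1 card_gt_0_iff)
  ultimately show ?thesis by simp
qed (simp add: card_gt_0_iff zero_power)

text \<open>Translation by 1 permutes the ring, so the sum of all elements is unchanged when the
  cardinality, read in the ring, is added to it.\<close>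

lemma of_nat_card_eq_0: "of_nat CARD('f::{ring_1,finite}) = (0::'f)"
proof -
  have "(\<Sum>y\<in>UNIV. y) = (\<Sum>y\<in>UNIV. y + (1::'f))"
    by (rule sum.reindex_bij_witness[of _ "\<lambda>y. y + 1" "\<lambda>y. y - 1"]) auto
  then show ?thesis by (simp add: sum.distrib)
qed

text \<open>The inverse of the automorphism \<open>theta n\<close> when the field has
  \<open>2 ^ (2 * n + 1)\<close> elements; it abbreviates the powers occurring in
  \<open>Sz_m\<close>.\<close>

definition rho :: "nat \<Rightarrow> 'f::field \<Rightarrow> 'f" where
  "rho n x = x ^ (2 ^ n)"

text \<open>Both the first coordinate of an ovoid point and the entry (4,1) of \<open>Sz_s\<close>.
  All calculations about the group and the ovoid reduce to identities for this form.\<close>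

definition tits_form :: "nat \<Rightarrow> 'f::field \<Rightarrow> 'f \<Rightarrow> 'f" where
  "tits_form n a b = a^2 * theta n a + a * b + theta n b"

locale suzuki_field =
  fixes n :: nat and F :: "'f::{field,finite} itself"
  assumes card_field: "CARD('f) = 2 ^ (2 * n + 1)"
begin

abbreviation \<theta> :: "'f \<Rightarrow> 'f" where "\<theta> \<equiv> theta n"
abbreviation \<rho> :: "'f \<Rightarrow> 'f" where "\<rho> \<equiv> rho n"
abbreviation N :: "'f \<Rightarrow> 'f \<Rightarrow> 'f" where "N \<equiv> tits_form n"

lemma two_eq_0: "(2::'f) = 0"
  using of_nat_card_eq_0[where 'f='f] by (simp only: card_field of_nat_power power_eq_0_iff) simp

text \<open>The simp rules up to \<open>add_eq_0\<close> set up arithmetic in characteristic 2: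
  signs disappear, numerals collapse to 0 or 1, and equal summands cancel.\<close>

lemma add_self [simp]: "(a::'f) + a = 0"
  using two_eq_0 by (metis mult_2 mult_zero_left)

lemma add_self_left [simp]: "(a::'f) + (a + b) = b"
  by (simp add: add.assoc[symmetric])

lemma uminus_eq [simp]: "- (a::'f) = a"
  by (simp add: minus_unique)

lemma minus_eq_add [simp]: "(a::'f) - b = a + b"
  by (simp add: diff_conv_add_uminus del: add_uminus_conv_diff)

lemma numerals_char2 [simp]: "numeral (Num.Bit0 k) = (0::'f)" "numeral (Num.Bit1 k) = (1::'f)"
  by (simp_all only: numeral_Bit0 numeral_Bit1 add_self add_0)

lemma add_eq_0 [simp]: "(a::'f) + b = 0 \<longleftrightarrow> a = b"
  by (metis add_self add_left_cancel)

lemma power2_add: "((x::'f) + y)^2 = x^2 + y^2"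
  by (simp add: power2_eq_square algebra_simps)

lemma frobenius_add: "((x::'f) + y) ^ (2 ^ k) = x ^ (2 ^ k) + y ^ (2 ^ k)"
proof (induction k)
  case (Suc k)
  have "(z::'f) ^ (2 ^ Suc k) = (z ^ (2 ^ k))^2" for z
    by (simp only: power_Suc2 power_mult)
  then show ?case using Suc by (simp only: power2_add)
qed simp

lemma theta_simps [simp]:
  "\<theta> 0 = 0" "\<theta> 1 = 1" "\<theta> (x + y) = \<theta> x + \<theta> y" "\<theta> (x * y) = \<theta> x * \<theta> y"
  "\<theta> (inverse x) = inverse (\<theta> x)" "\<theta> (x / y) = \<theta> x / \<theta> y" "\<theta> (x ^ k) = \<theta> x ^ k"
  "\<theta> x = 0 \<longleftrightarrow> x = 0"
  unfolding theta_def
  by (simp_all only: frobenius_add power_mult_distrib power_inverse power_divide power_one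
      power_zero_numeral power_eq_0_iff mult.commute flip: power_mult) simp_all

lemma rho_simps [simp]:
  "\<rho> 0 = 0" "\<rho> 1 = 1" "\<rho> (x * y) = \<rho> x * \<rho> y" "\<rho> (x ^ k) = \<rho> x ^ k"
  "\<rho> (inverse x) = inverse (\<rho> x)" "\<rho> (x / y) = \<rho> x / \<rho> y" "\<rho> x = 0 \<longleftrightarrow> x = 0"
  by (simp_all add: rho_def power_mult_distrib power_inverse power_divide) 
    (simp add: mult.commute flip: power_mult)

lemma theta_theta [simp]: "\<theta> (\<theta> x) = x^2"
proof -
  have "(2::nat) ^ (n + 1) * 2 ^ (n + 1) = 2 ^ (2 * n + 1) * 2"
    by (simp add: mult_2 flip: power_add power_Suc power_Suc2)
  then have "\<theta> (\<theta> x) = (x ^ CARD('f))^2"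
    by (simp only: theta_def card_field flip: power_mult)
  then show ?thesis by (simp add: finite_field_power_card)
qed

lemma rho_square: "\<rho> x ^ 2 = \<theta> x"
  by (simp add: rho_def theta_def mult.commute[of 2] power_mult)

lemma rho_theta [simp]: "\<rho> (\<theta> x) = x"
proof -
  have "(2::nat) ^ (n + 1) * 2 ^ n = 2 ^ (2 * n + 1)"
    by (simp add: mult_2 flip: power_add power_Suc)
  then have "\<rho> (\<theta> x) = x ^ CARD('f)"
    by (simp only: rho_def theta_def card_field flip: power_mult)
  then show ?thesis by (simp add: finite_field_power_card)
qed

lemma theta_N: "\<theta> (N a b) = \<theta> a ^ 2 * a^2 + \<theta> a * \<theta> b + b^2"
  by (simp add: tits_form_def)

lemma N_0_left [simp]: "N 0 b = \<theta> b"
  by (simp add: tits_form_def)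

text \<open>
  For \<open>a \<noteq> 0\<close>, \<open>N a b = 0\<close> means \<open>\<theta> t = t + 1\<close> with \<open>t = b / (a \<theta>(a))\<close>; applying \<open>\<theta>\<close> again gives
  \<open>t\<^sup>2 = t\<close>, hence \<open>\<theta> t = t\<close>.
\<close>

lemma N_eq_0_iff [simp]: "N a b = 0 \<longleftrightarrow> a = 0 \<and> b = 0"
proof (cases "a = 0")
  case False
  define t where "t = b / (a * \<theta> a)"
  have b: "b = a * \<theta> a * t" using False by (simp add: t_def)
  have "N a b = a^2 * \<theta> a * (1 + t + \<theta> t)"
    by (simp add: tits_form_def b algebra_simps power2_eq_square)
  moreover have "1 + t + \<theta> t \<noteq> 0"
  proof
    assume "1 + t + \<theta> t = 0"
    then have *: "\<theta> t = 1 + t" by simp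
    then have "\<theta> (\<theta> t) = t" by simp
    then have "t = 0 \<or> t = 1"
      by (simp add: power2_eq_square)
    then show False using * by auto
  qed
  ultimately show ?thesis using False by simp
qed simp

text \<open>The right-hand side is the first coordinate of \<open>p(a,b)\<close> times
  \<open>s(x,y)\<close>, so this is the invariance of the ovoid under \<open>s\<close>.
  \<open>N_scale\<close> and \<open>N_invert\<close> play the same role for \<open>m\<close> and for
  \<tau>.\<close>

lemma N_translate:
  "N (a + x) (b + y + (a + x) * \<theta> x) = N a b + b * x + a * y + N x y"
  by (simp add: tits_form_def algebra_simps power2_eq_square)

text \<open>The inverse of \<open>s(a,b)\<close> is \<open>s(a, b + a \<theta>(a))\<close>, so the
  form takes equal values on the parameters of mutually inverse elements.\<close>

lemma N_shear: "N a (b + a * \<theta> a) = N a b"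
  by (simp add: tits_form_def algebra_simps power2_eq_square)

lemma N_scale: "N (k * a) (k * \<theta> k * b) = k^2 * \<theta> k * N a b"
  by (simp add: tits_form_def algebra_simps power2_eq_square)

lemma N_invert:
  assumes "N a b \<noteq> 0"
  shows "N (b / N a b) (a / N a b) = 1 / N a b"
proof -
  define c where "c = N a b"
  have c: "c \<noteq> 0" "\<theta> c \<noteq> 0" using assms by (auto simp: c_def)
  \<comment> \<open>Replacing \<open>\<theta> c\<close> by \<open>theta_N\<close> leaves only
    \<open>a\<close>, \<open>b\<close> and their images under \<theta>, so the claim becomes a
    polynomial identity.\<close>
  have "b^2 * \<theta> b + a * b * \<theta> c + \<theta> a * c^2 = c * \<theta> c"
    unfolding c_def theta_N by (simp add: tits_form_def algebra_simps power2_eq_square)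
  moreover have "N (b / c) (a / c) = (b^2 * \<theta> b + a * b * \<theta> c + \<theta> a * c^2) / (c^2 * \<theta> c)"
    using c by (simp add: tits_form_def field_simps power2_eq_square)
  ultimately show ?thesis using c by (simp add: c_def[symmetric] power2_eq_square)
qed

end

section \<open>Relations between the generators\<close>

lemma vector_4 [simp]:
  "(vector [x, y, z, w] :: 'a::zero^4) $ 1 = x"
  "(vector [x, y, z, w] :: 'a::zero^4) $ 2 = y"
  "(vector [x, y, z, w] :: 'a::zero^4) $ 3 = z"
  "(vector [x, y, z, w] :: 'a::zero^4) $ 4 = w"
  unfolding vector_def by simp_all

lemma Sz_s_vector:
  "Sz_s n x y = vector [vector [1, 0, 0, 0], vector [x, 1, 0, 0], vector [y, theta n x, 1, 0],
     vector [tits_form n x y, x * theta n x + y, x, 1]]"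
  by (simp add: Sz_s_def vec_eq_iff forall_4 elem_mat_def mat_def tits_form_def)

lemma Sz_m_vector:
  "Sz_m n k = vector [vector [k * rho n k, 0, 0, 0], vector [0, rho n k, 0, 0],
     vector [0, 0, inverse (rho n k), 0], vector [0, 0, 0, inverse (k * rho n k)]]"
proof -
  have *: "k powi (2 ^ n) = rho n k"
    by (simp add: rho_def flip: power_int_of_nat)
  \<comment> \<open>The exponent law needs a nonzero base or an exponent other than -1. The second
    alternative keeps the matrix formula valid for \<open>k = 0\<close>.\<close>
  have "(2::int) ^ n \<noteq> - 1" by (smt (verit) zero_le_power)
  then have **: "k powi (1 + 2 ^ n) = k * rho n k"
    using power_int_add_1'[of k "2 ^ n"] * by (simp add: add.commute)
  have "k powi (- (2 ^ n)) = inverse (rho n k)" "k powi (- 1 - 2 ^ n) = inverse (k * rho n k)"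
    using power_int_minus[of k "1 + 2 ^ n"] * ** by (simp_all add: power_int_minus)
  with * ** show ?thesis
    by (simp add: Sz_m_def vec_eq_iff forall_4 elem_mat_def)
qed

lemma Sz_tau_vector:
  "Sz_tau = vector [vector [0, 0, 0, 1], vector [0, 0, 1, 0],
     vector [0, 1, 0, 0], vector [1, 0, 0, 0]]"
  by (simp add: Sz_tau_def vec_eq_iff forall_4 elem_mat_def)

lemma mat_1_vector: "mat 1 = (vector [vector [1, 0, 0, 0], vector [0, 1, 0, 0],
     vector [0, 0, 1, 0], vector [0, 0, 0, 1]] :: 'f::field^4^4)"
  by (simp add: vec_eq_iff forall_4 mat_def)

lemmas Sz_vector = Sz_s_vector Sz_m_vector Sz_tau_vector mat_1_vector

lemmas matrix_mult_4 = vec_eq_iff forall_4 matrix_matrix_mult_def sum_4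

context suzuki_field
begin

abbreviation s :: "'f \<Rightarrow> 'f \<Rightarrow> 'f^4^4" where "s \<equiv> Sz_s n"
abbreviation m :: "'f \<Rightarrow> 'f^4^4" where "m \<equiv> Sz_m n"
abbreviation \<tau> :: "'f^4^4" where "\<tau> \<equiv> Sz_tau"

lemma s_0: "s 0 0 = mat 1"
  by (simp add: Sz_vector)

lemma m_1: "m 1 = mat 1"
  by (simp add: Sz_vector)

lemma s_s: "s x y ** s x' y' = s (x + x') (y + y' + x' * \<theta> x)"
  unfolding Sz_vector
  by (simp add: matrix_mult_4 tits_form_def algebra_simps power2_eq_square)

lemma m_m: "m k ** m k' = m (k * k')"
  unfolding Sz_vector by (simp add: matrix_mult_4 algebra_simps)

lemma tau_tau: "\<tau> ** \<tau> = mat 1"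
  unfolding Sz_vector by (simp add: matrix_mult_4)

lemma m_tau: "k \<noteq> 0 \<Longrightarrow> m k ** \<tau> = \<tau> ** m (inverse k)"
  unfolding Sz_vector by (simp add: matrix_mult_4)

lemma s_m:
  assumes "k \<noteq> 0"
  shows "s x y ** m k = m k ** s (k * x) (k * \<theta> k * y)"
proof -
  \<comment> \<open>The diagonal entries involve \<open>\<rho> k\<close>, the conjugated parameters
    \<open>\<theta> k\<close>; this relation reconciles them.\<close>
  have "\<theta> k = \<rho> k * \<rho> k" by (simp add: power2_eq_square flip: rho_square)
  then show ?thesis using assms N_scale[of k x y] unfolding Sz_vector
    by (simp add: matrix_mult_4 field_simps power2_eq_square)
qed

text \<open>
  The right factor is determined by the image \<open>p(b/c, x/c)\<close> of \<open>\<infinity>\<close> under \<open>\<tau> s(x,y) \<tau>\<close>, the left factor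
  likewise by the inverse matrix, and the diagonal factor by \<open>\<kappa> \<rho>(\<kappa>) = c\<close>, solved by \<open>\<kappa> = c\<^sup>2 / \<theta>(c)\<close>.
\<close>

lemma tau_s_tau:
  fixes x y :: 'f
  defines "c \<equiv> N x y" and "b \<equiv> y + x * \<theta> x"
  assumes "c \<noteq> 0"
  shows "\<tau> ** s x y ** \<tau> =
    s (y / c) (x / c) ** m (c^2 / \<theta> c) ** \<tau> ** s (b / c) (x / c + b * \<theta> b / (c * \<theta> c))"
proof -
  have c: "c \<noteq> 0" "\<theta> c \<noteq> 0" using assms by auto
  have c_eq: "c = x^2 * \<theta> x + x * y + \<theta> y"
    and theta_c: "\<theta> c = \<theta> x^2 * x^2 + \<theta> x * \<theta> y + y^2"
    by (simp_all add: c_def tits_form_def)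
  have N1: "N (y / c) (x / c) = 1 / c"
    using N_invert assms by simp
  have theta_b: "\<theta> b = \<theta> y + \<theta> x * x^2"
    by (simp add: b_def)
  have "N x b = c"
    by (simp add: c_def b_def N_shear)
  then have N2: "N (b / c) (x / c + b * \<theta> b / (c * \<theta> c)) = 1 / c"
    using N_invert[of x b] N_shear[of "b / c" "x / c"] c by simp
  have "\<rho> (c^2 / \<theta> c) = \<theta> c / c"
    by (simp add: rho_square)
  then have m: "m (c^2 / \<theta> c) = vector [vector [c, 0, 0, 0], vector [0, \<theta> c / c, 0, 0],
      vector [0, 0, c / \<theta> c, 0], vector [0, 0, 0, 1 / c]]"
    using c by (simp add: Sz_m_vector power2_eq_square divide_simps)
  \<comment> \<open>Denominators are cleared while \<open>c\<close> is still opaque; only the last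
    simplification expands \<open>c\<close> and \<open>\<theta> c\<close> into polynomials.\<close>
  show ?thesis unfolding m Sz_s_vector Sz_tau_vector N1 N2 c_def[symmetric]
    using c
    by (simp add: matrix_mult_4, simp add: field_simps theta_b power2_eq_square,
        simp add: c_eq theta_c b_def algebra_simps power2_eq_square)
qed

end

section \<open>Designs from doubly transitive group actions\<close>

lemma (in group_action) image_comp:
  assumes "g \<in> carrier G" "h \<in> carrier G" "B \<subseteq> E"
  shows "\<phi> (g \<otimes> h) ` B = \<phi> g ` \<phi> h ` B"
  using assms by (auto simp: image_image composition_rule subset_iff intro!: image_cong)

lemma (in group_action) image_subset: "g \<in> carrier G \<Longrightarrow> B \<subseteq> E \<Longrightarrow> \<phi> g ` B \<subseteq> E"
  using surj_prop by blast

lemma (in group_action) image_one: "B \<subseteq> E \<Longrightarrow> \<phi> \<one> ` B = B"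
  by (force simp: id_eq_one[symmetric])

lemma (in group_action) group_G: "group G"
  using group_hom by (rule group_hom.axioms(1))

lemma (in group_action) image_inv:
  assumes "g \<in> carrier G" "B \<subseteq> E"
  shows "\<phi> (inv g) ` \<phi> g ` B = B" "\<phi> g ` \<phi> (inv g) ` B = B"
proof -
  interpret group G by (rule group_G)
  show "\<phi> (inv g) ` \<phi> g ` B = B" "\<phi> g ` \<phi> (inv g) ` B = B"
    using assms image_one by (simp_all flip: image_comp)
qed

text \<open>Members of \<open>Bij E\<close> are extensional, so multiplicativity on points of
  \<open>E\<close> already gives equality of the functions.\<close>

lemma group_actionI:
  assumes "group G"
    and bij: "\<And>g. g \<in> carrier G \<Longrightarrow> \<phi> g \<in> Bij E"
    and mult: "\<And>g h x. g \<in> carrier G \<Longrightarrow> h \<in> carrier G \<Longrightarrow> x \<in> E \<Longrightarrow>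
      \<phi> (g \<otimes>\<^bsub>G\<^esub> h) x = \<phi> g (\<phi> h x)"
  shows "group_action G E \<phi>"
proof -
  interpret group G by fact
  have "\<phi> (g \<otimes>\<^bsub>G\<^esub> h) = compose E (\<phi> g) (\<phi> h)" if "g \<in> carrier G" "h \<in> carrier G" for g h
    using that bij[of "g \<otimes>\<^bsub>G\<^esub> h"] mult
    by (intro extensionalityI[of _ E]) (auto simp: Bij_imp_extensional compose_eq)
  then have "\<phi> \<in> hom G (BijGroup E)"
    using bij by (auto simp: hom_def BijGroup_def)
  then show ?thesis
    by (simp add: group_action_def group_hom_def group_hom_axioms_def group_BijGroup is_group)
qed

section \<open>Double transitivity and primitivity\<close>

definition doubly_transitive ::
    "('g, 'm) monoid_scheme \<Rightarrow> 'p set \<Rightarrow> ('g \<Rightarrow> 'p \<Rightarrow> 'p) \<Rightarrow> bool" where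
  "doubly_transitive G E \<phi> \<longleftrightarrow>
    (\<forall>a\<in>E. \<forall>b\<in>E. \<forall>c\<in>E. \<forall>d\<in>E. a \<noteq> b \<longrightarrow> c \<noteq> d \<longrightarrow> (\<exists>g\<in>carrier G. \<phi> g a = c \<and> \<phi> g b = d))"

lemma doubly_transitiveE:
  assumes "doubly_transitive G E \<phi>" "a \<in> E" "b \<in> E" "c \<in> E" "d \<in> E" "a \<noteq> b" "c \<noteq> d"
  obtains g where "g \<in> carrier G" "\<phi> g a = c" "\<phi> g b = d"
  using assms unfolding doubly_transitive_def by meson

context group_action
begin

lemma doubly_transitive_imp_transitive:
  assumes "doubly_transitive G E \<phi>" "x \<in> E" "y \<in> E"
  shows "\<exists>g\<in>carrier G. \<phi> g x = y"
proof (cases "x = y")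
  case True
  interpret group G by (rule group_G)
  show ?thesis using True assms id_eq_one by (metis one_closed restrict_apply')
next
  case False
  \<comment> \<open>The element chosen interchanges \<open>x\<close> and \<open>y\<close>, so no
    third point is called for.\<close>
  then show ?thesis using doubly_transitiveE[OF assms(1,2,3) assms(3,2)] by metis
qed

lemma doubly_transitiveI:
  assumes p: "p \<in> E" and r: "r \<in> E"
    and to_p: "\<And>a. a \<in> E \<Longrightarrow> \<exists>g\<in>carrier G. \<phi> g a = p"
    and to_r: "\<And>a. a \<in> E \<Longrightarrow> a \<noteq> p \<Longrightarrow> \<exists>g\<in>carrier G. \<phi> g p = p \<and> \<phi> g a = r"
  shows "doubly_transitive G E \<phi>"
  unfolding doubly_transitive_def
proof (intro ballI impI)
  interpret group G by (rule group_G)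
  have base: "\<exists>g\<in>carrier G. \<phi> g a = p \<and> \<phi> g b = r" if ab: "a \<in> E" "b \<in> E" "a \<noteq> b" for a b
  proof -
    obtain g where g: "g \<in> carrier G" "\<phi> g a = p" using to_p ab by metis
    have "\<phi> g b \<in> E" using element_image[OF g(1) ab(2) refl] .
    moreover have "\<phi> g b \<noteq> p" using inj_onD[OF inj_prop[OF g(1)]] g ab by metis
    ultimately obtain h where h: "h \<in> carrier G" "\<phi> h p = p" "\<phi> h (\<phi> g b) = r"
      using to_r by metis
    then have "\<phi> (h \<otimes> g) a = p" "\<phi> (h \<otimes> g) b = r" "h \<otimes> g \<in> carrier G"
      using g ab by (simp_all add: composition_rule)
    then show ?thesis by blast
  qed
  fix a b c d assume E: "a \<in> E" "b \<in> E" "c \<in> E" "d \<in> E" and ne: "a \<noteq> b" "c \<noteq> d"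
  obtain g h where g: "g \<in> carrier G" "\<phi> g a = p" "\<phi> g b = r"
    and h: "h \<in> carrier G" "\<phi> h c = p" "\<phi> h d = r"
    using base E ne by metis
  have "\<phi> (inv h) p = c" "\<phi> (inv h) r = d"
    using orbit_sym_aux h E by blast+
  then have "\<phi> (inv h \<otimes> g) a = c" "\<phi> (inv h \<otimes> g) b = d" "inv h \<otimes> g \<in> carrier G"
    using g h E by (simp_all add: composition_rule)
  then show "\<exists>g\<in>carrier G. \<phi> g a = c \<and> \<phi> g b = d" by blast
qed

lemma doubly_transitive_imp_primitive:
  assumes dt: "doubly_transitive G E \<phi>"
  shows "primitive_action G E \<phi>"
  unfolding primitive_action_def
proof (intro conjI allI impI)
  show "transitive_action G E \<phi>"
    by unfold_locales (rule doubly_transitive_imp_transitive[OF dt])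
next
  fix \<C> assume *: "partition_on E \<C> \<and> preserves_partition G \<phi> \<C>"
  then have E: "E = \<Union>\<C>" and disj: "disjoint \<C>" and ne: "{} \<notin> \<C>"
    by (auto simp: partition_on_def)
  show "trivial_partition E \<C>"
  proof (cases "\<exists>C\<in>\<C>. \<exists>a\<in>C. \<exists>b\<in>C. a \<noteq> b")
    case True
    then obtain C a b where C: "C \<in> \<C>" "a \<in> C" "b \<in> C" "a \<noteq> b" by metis
    then have ab: "a \<in> E" "b \<in> E" using E by auto
    have "d \<in> C" if d: "d \<in> E" for d
    proof (cases "d = a")
      case False
      then obtain g where g: "g \<in> carrier G" "\<phi> g a = a" "\<phi> g b = d"
        using doubly_transitiveE[OF dt ab(1,2) ab(1) d C(4)] by metis
      have "\<phi> g ` C \<in> \<C>"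
        using * C g(1) by (simp add: preserves_partition_def)
      moreover have "a \<in> \<phi> g ` C" "d \<in> \<phi> g ` C"
        using C g(2,3) by (metis imageI)+
      ultimately show ?thesis using disj C by (metis disjointD disjoint_iff)
    qed (use C in simp)
    then have CE: "C = E" using C E by auto
    have "D = E" if D: "D \<in> \<C>" for D
    proof (rule ccontr)
      assume "D \<noteq> E"
      then have "D \<inter> E = {}" using disjointD[OF disj D C(1)] CE by simp
      moreover have "D \<subseteq> E" using D E by auto
      ultimately have "D = {}" by auto
      then show False using D ne by simp
    qed
    then have "\<C> = {E}" using C(1) CE by blast
    then show ?thesis by (simp add: trivial_partition_def)
  next
    case False
    have "\<C> = (\<lambda>\<omega>. {\<omega>}) ` E"
    proof (intro equalityI subsetI)
      fix C assume "C \<in> \<C>"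
      moreover from this obtain a where "a \<in> C" using ne by (metis ex_in_conv)
      ultimately have "C = {a}" "a \<in> E" using False E by auto
      then show "C \<in> (\<lambda>\<omega>. {\<omega>}) ` E" by simp
    next
      fix D assume "D \<in> (\<lambda>\<omega>. {\<omega>}) ` E"
      then obtain a where a: "a \<in> E" "D = {a}" by auto
      then obtain C where "C \<in> \<C>" "a \<in> C" using E by auto
      then have "C = {a}" using False by auto
      then show "D \<in> \<C>" using a \<open>C \<in> \<C>\<close> by simp
    qed
    then show ?thesis by (simp add: trivial_partition_def)
  qed
qed

end

lemma card_offdiag:
  assumes "finite A"
  shows "card {(x, y). x \<in> A \<and> y \<in> A \<and> x \<noteq> y} = card A * (card A - 1)"
proof -
  have "{(x, y). x \<in> A \<and> y \<in> A \<and> x \<noteq> y} = Sigma A (\<lambda>x. A - {x})" by auto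
  then show ?thesis using assms by (simp add: card_SigmaI)
qed

locale orbit_design = group_action G E \<phi>
    for G :: "('g, 'm) monoid_scheme" (structure) and E :: "'p set" and \<phi> +
  fixes \<Delta> :: "'p set" and \<B> :: "'p set set"
  assumes finite_E: "finite E"
    and Delta_subset: "\<Delta> \<subseteq> E"
    and blocks: "\<B> = {\<phi> g ` \<Delta> | g. g \<in> carrier G}"
begin

sublocale group G by (rule group_G)

lemma block_subset: "B \<in> \<B> \<Longrightarrow> B \<subseteq> E"
  unfolding blocks using image_subset[OF _ Delta_subset] by blast

lemma finite_blocks: "finite \<B>"
  using finite_subset[of \<B> "Pow E"] finite_E block_subset by blast

lemma image_block: "g \<in> carrier G \<Longrightarrow> B \<in> \<B> \<Longrightarrow> \<phi> g ` B \<in> \<B>"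
  unfolding blocks using image_comp[OF _ _ Delta_subset] by (auto intro: m_closed) (metis m_closed)

lemma card_block: "B \<in> \<B> \<Longrightarrow> card B = card \<Delta>"
  unfolding blocks using inj_on_subset[OF inj_prop Delta_subset] by (auto simp: card_image)

lemma blocks_transitive:
  assumes "B \<in> \<B>" "B' \<in> \<B>"
  shows "\<exists>g\<in>carrier G. \<phi> g ` B = B'"
proof -
  obtain g h where gh: "g \<in> carrier G" "h \<in> carrier G" "B = \<phi> g ` \<Delta>" "B' = \<phi> h ` \<Delta>"
    using assms by (auto simp: blocks)
  then have "\<phi> (h \<otimes> inv g) ` B = B'"
    using Delta_subset by (simp add: image_comp image_inv image_subset)
  then show ?thesis using gh by blast
qed

lemma card_blocks_containing:
  assumes g: "g \<in> carrier G" and S: "S \<subseteq> E"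
  shows "card {B\<in>\<B>. \<phi> g ` S \<subseteq> B} = card {B\<in>\<B>. S \<subseteq> B}"
proof -
  have sub: "S \<subseteq> \<phi> (inv g) ` B" if "B \<in> \<B>" "\<phi> g ` S \<subseteq> B" for B
    using image_mono[OF that(2), of "\<phi> (inv g)"] g S by (simp add: image_inv)
  have "bij_betw ((`) (\<phi> g)) {B\<in>\<B>. S \<subseteq> B} {B\<in>\<B>. \<phi> g ` S \<subseteq> B}"
    by (rule bij_betwI[where g = "(`) (\<phi> (inv g))"])
      (use g sub image_inv block_subset image_block in \<open>auto simp: image_mono\<close>)
  then show ?thesis by (metis bij_betw_same_card)
qed

lemma sum_card_blocks_containing:
  fixes T :: "'c set" and f :: "'c \<Rightarrow> 'p set"
  assumes "finite T"
  shows "(\<Sum>t\<in>T. card {B\<in>\<B>. f t \<subseteq> B}) = (\<Sum>B\<in>\<B>. card {t\<in>T. f t \<subseteq> B})"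
  using sum_multicount_gen[OF assms finite_blocks, of "\<lambda>t B. f t \<subseteq> B"] by auto

lemma card_blocks_on_point:
  assumes tr: "\<And>x y. x \<in> E \<Longrightarrow> y \<in> E \<Longrightarrow> \<exists>g\<in>carrier G. \<phi> g x = y" and \<omega>: "\<omega> \<in> E"
  shows "card E * card {B\<in>\<B>. \<omega> \<in> B} = card \<B> * card \<Delta>"
proof -
  have "card {B\<in>\<B>. {x} \<subseteq> B} = card {B\<in>\<B>. {\<omega>} \<subseteq> B}" if "x \<in> E" for x
    using tr[OF \<omega> that] card_blocks_containing[of _ "{\<omega>}"] \<omega> by force
  then have "card E * card {B\<in>\<B>. {\<omega>} \<subseteq> B} = (\<Sum>x\<in>E. card {B\<in>\<B>. {x} \<subseteq> B})"
    by simp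
  also have "\<dots> = (\<Sum>B\<in>\<B>. card {x\<in>E. {x} \<subseteq> B})"
    by (rule sum_card_blocks_containing[OF finite_E])
  also have "\<dots> = (\<Sum>B\<in>\<B>. card \<Delta>)"
    using block_subset card_block by (intro sum.cong) (auto intro!: arg_cong[where f = card] simp flip: card_block)
  finally show ?thesis by simp
qed

lemma card_blocks_on_pair:
  assumes dt: "doubly_transitive G E \<phi>" and \<omega>: "\<omega> \<in> E" "\<omega>' \<in> E" "\<omega> \<noteq> \<omega>'"
  shows "card E * (card E - 1) * card {B\<in>\<B>. \<omega> \<in> B \<and> \<omega>' \<in> B}
    = card \<B> * (card \<Delta> * (card \<Delta> - 1))"
proof -
  let ?T = "\<lambda>A. {(x, y). x \<in> A \<and> y \<in> A \<and> x \<noteq> y}"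
  let ?f = "\<lambda>(x, y). {x, y}"
  have fin: "finite (?T E)"
    by (rule finite_subset[of _ "E \<times> E"]) (use finite_E in auto)
  have "card {B\<in>\<B>. ?f t \<subseteq> B} = card {B\<in>\<B>. {\<omega>, \<omega>'} \<subseteq> B}" if t: "t \<in> ?T E" for t
  proof -
    obtain x y where xy: "t = (x, y)" "x \<in> E" "y \<in> E" "x \<noteq> y" using t by auto
    obtain g where "g \<in> carrier G" "\<phi> g \<omega> = x" "\<phi> g \<omega>' = y"
      using doubly_transitiveE[OF dt \<omega>(1,2) xy(2,3) \<omega>(3) xy(4)] .
    then have "g \<in> carrier G" "?f t = \<phi> g ` {\<omega>, \<omega>'}" using xy by auto
    then show ?thesis using card_blocks_containing[of g "{\<omega>, \<omega>'}"] \<omega> by simp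
  qed
  then have "card (?T E) * card {B\<in>\<B>. {\<omega>, \<omega>'} \<subseteq> B} = (\<Sum>t\<in>?T E. card {B\<in>\<B>. ?f t \<subseteq> B})"
    by simp
  also have "\<dots> = (\<Sum>B\<in>\<B>. card {t\<in>?T E. ?f t \<subseteq> B})"
    by (rule sum_card_blocks_containing[OF fin])
  also have "\<dots> = (\<Sum>B\<in>\<B>. card \<Delta> * (card \<Delta> - 1))"
  proof (rule sum.cong)
    fix B assume B: "B \<in> \<B>"
    have eq: "{t\<in>?T E. ?f t \<subseteq> B} = ?T B" using block_subset[OF B] by auto
    have fin_B: "finite B" using finite_subset[OF block_subset[OF B] finite_E] .
    show "card {t\<in>?T E. ?f t \<subseteq> B} = card \<Delta> * (card \<Delta> - 1)"
      unfolding eq card_offdiag[OF fin_B] card_block[OF B] ..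
  qed simp
  finally show ?thesis using card_offdiag[OF finite_E] by simp
qed

lemma two_designI:
  assumes "doubly_transitive G E \<phi>" "card E = v" "card \<Delta> = k" "v > 1"
    and "card \<B> * (k * (k - 1)) = v * (v - 1) * l"
  shows "two_design E \<B> v k l"
  unfolding two_design_def
proof (intro conjI ballI impI)
  fix \<omega> \<omega>' assume "\<omega> \<in> E" "\<omega>' \<in> E" "\<omega> \<noteq> \<omega>'"
  then have "v * (v - 1) * card {B\<in>\<B>. \<omega> \<in> B \<and> \<omega>' \<in> B} = v * (v - 1) * l"
    using card_blocks_on_pair assms by simp
  then show "card {B\<in>\<B>. \<omega> \<in> B \<and> \<omega>' \<in> B} = l" using assms(4) by simp
qed (use assms finite_E block_subset card_block in auto)

lemma has_replication_numberI:
  assumes "doubly_transitive G E \<phi>" "card E = v" "card \<Delta> = k" "v > 0"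
    and "card \<B> * k = v * r"
  shows "has_replication_number E \<B> k r"
  unfolding has_replication_number_def
proof (intro conjI ballI)
  show "of_nat (card \<B> * k) / of_nat (card E) = (of_nat r :: rat)"
    using assms(2,4,5) by simp
  fix \<omega> assume "\<omega> \<in> E"
  then have "v * card {B\<in>\<B>. \<omega> \<in> B} = v * r"
    using card_blocks_on_point[OF doubly_transitive_imp_transitive[OF assms(1)]] assms by simp
  then show "card {B\<in>\<B>. \<omega> \<in> B} = r" using assms(4) by simp
qed

lemma flag_transitiveI:
  assumes stab: "\<And>x y. x \<in> \<Delta> \<Longrightarrow> y \<in> \<Delta> \<Longrightarrow> \<exists>g\<in>carrier G. \<phi> g ` \<Delta> = \<Delta> \<and> \<phi> g x = y"
  shows "flag_transitive G \<phi> E \<B>"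
proof -
  have *: "\<exists>g\<in>carrier G. \<phi> g \<omega> = \<omega>' \<and> \<phi> g ` B = B'"
    if B: "B \<in> \<B>" "B' \<in> \<B>" "\<omega> \<in> B" "\<omega>' \<in> B'" for \<omega> \<omega>' B B'
  proof -
    obtain g h x y where g: "g \<in> carrier G" "B = \<phi> g ` \<Delta>" "x \<in> \<Delta>" "\<omega> = \<phi> g x"
      and h: "h \<in> carrier G" "B' = \<phi> h ` \<Delta>" "y \<in> \<Delta>" "\<omega>' = \<phi> h y"
      using B by (auto simp: blocks)
    obtain k where k: "k \<in> carrier G" "\<phi> k ` \<Delta> = \<Delta>" "\<phi> k x = y" using stab g h by blast
    have xE: "x \<in> E" "\<phi> g x \<in> E" using g Delta_subset element_image by blast+
    have "\<phi> (h \<otimes> (k \<otimes> inv g)) \<omega> = \<omega>'"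
      using g h k xE Delta_subset composition_rule by (simp add: orbit_sym_aux)
    moreover have "\<phi> (h \<otimes> (k \<otimes> inv g)) ` B = B'"
      using g h k Delta_subset by (simp add: image_comp image_inv image_subset)
    moreover have "h \<otimes> (k \<otimes> inv g) \<in> carrier G" using g h k by simp
    ultimately show ?thesis by blast
  qed
  show ?thesis unfolding flag_transitive_def flags_def by clarsimp (rule *; assumption)
qed

lemma design_automorphism_groupI:
  "faithful_action G E \<phi> \<Longrightarrow> design_automorphism_group G \<phi> E \<B>"
  using image_block by (simp add: design_automorphism_group_def)

lemma block_action_transitive: "transitive_action G \<B> (block_action \<phi> \<B>)"
proof -
  have inv: "\<phi> (inv g) ` \<phi> g ` B = B" "\<phi> g ` \<phi> (inv g) ` B = B" if "g \<in> carrier G" "B \<in> \<B>" for g B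
    using image_inv[OF that(1) block_subset[OF that(2)]] .
  have "bij_betw (block_action \<phi> \<B> g) \<B> \<B>" if "g \<in> carrier G" for g
    by (rule bij_betwI[where g = "block_action \<phi> \<B> (inv g)"])
      (use that inv image_block in \<open>auto simp: block_action_def\<close>)
  then have "block_action \<phi> \<B> g \<in> Bij \<B>" if "g \<in> carrier G" for g
    using that by (auto simp: Bij_def block_action_def)
  then have "group_action G \<B> (block_action \<phi> \<B>)"
    using block_subset
    by (intro group_actionI is_group) (auto simp: block_action_def image_comp image_block)
  moreover have "\<exists>g\<in>carrier G. block_action \<phi> \<B> g B = B'" if "B \<in> \<B>" "B' \<in> \<B>" for B B'
    using blocks_transitive[OF that] that by (auto simp: block_action_def)
  ultimately show ?thesis
    by (simp add: transitive_action_def transitive_action_axioms_def)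
qed

end

text \<open>
  If the stabiliser of the base block fixes a point, every block inherits a distinguished point,
  and the blocks with a common distinguished point form a system of imprimitivity.
\<close>

locale pointed_orbit_design = orbit_design G E \<phi> \<Delta> \<B>
    for G :: "('g, 'm) monoid_scheme" (structure) and E :: "'p set" and \<phi> \<Delta> \<B> +
  fixes \<pi> :: 'p
  assumes base_point: "\<pi> \<in> E"
    and stab_le: "\<And>g. g \<in> carrier G \<Longrightarrow> \<phi> g ` \<Delta> = \<Delta> \<Longrightarrow> \<phi> g \<pi> = \<pi>"
    and transitive: "\<And>x y. x \<in> E \<Longrightarrow> y \<in> E \<Longrightarrow> \<exists>g\<in>carrier G. \<phi> g x = y"
begin

definition fibre :: "'p \<Rightarrow> 'p set set" where
  "fibre \<omega> = {\<phi> g ` \<Delta> | g. g \<in> carrier G \<and> \<phi> g \<pi> = \<omega>}"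

lemma fibre_subset: "fibre \<omega> \<subseteq> \<B>"
  by (auto simp: fibre_def blocks)

lemma fibre_block_subset: "B \<in> fibre \<omega> \<Longrightarrow> B \<subseteq> E"
  using fibre_subset block_subset by (meson subsetD)

lemma fibre_disjoint:
  assumes "B \<in> fibre \<omega>" "B \<in> fibre \<omega>'"
  shows "\<omega> = \<omega>'"
proof -
  obtain g h where g: "g \<in> carrier G" "\<phi> g \<pi> = \<omega>" "B = \<phi> g ` \<Delta>"
    and h: "h \<in> carrier G" "\<phi> h \<pi> = \<omega>'" "B = \<phi> h ` \<Delta>"
    using assms by (auto simp: fibre_def)
  have "\<phi> (inv h \<otimes> g) ` \<Delta> = \<Delta>"
    using image_comp[of "inv h" g] image_inv(1)[of h \<Delta>] g h Delta_subset by simp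
  then have "\<phi> (inv h) (\<phi> g \<pi>) = \<pi>"
    using stab_le[of "inv h \<otimes> g"] g h composition_rule[of \<pi> "inv h" g] base_point by simp
  then have "\<phi> h \<pi> = \<phi> g \<pi>"
    using orbit_sym_aux[of "inv h" "\<phi> g \<pi>" \<pi>] g h element_image[OF g(1) base_point refl] by simp
  then show ?thesis using g h by simp
qed

lemma fibre_image:
  assumes g: "g \<in> carrier G" and \<omega>: "\<omega> \<in> E"
  shows "(`) (\<phi> g) ` fibre \<omega> = fibre (\<phi> g \<omega>)"
proof -
  have sub: "(`) (\<phi> g) ` fibre \<omega> \<subseteq> fibre (\<phi> g \<omega>)" if g: "g \<in> carrier G" for g \<omega>
  proof
    fix B assume "B \<in> (`) (\<phi> g) ` fibre \<omega>"
    then obtain h where h: "h \<in> carrier G" "\<phi> h \<pi> = \<omega>" "B = \<phi> g ` \<phi> h ` \<Delta>"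
      by (auto simp: fibre_def)
    then have "B = \<phi> (g \<otimes> h) ` \<Delta>" "\<phi> (g \<otimes> h) \<pi> = \<phi> g \<omega>"
      using g Delta_subset base_point by (simp_all add: image_comp composition_rule)
    then show "B \<in> fibre (\<phi> g \<omega>)" unfolding fibre_def using g h by blast
  qed
  have "fibre (\<phi> g \<omega>) = (`) (\<phi> g) ` (`) (\<phi> (inv g)) ` fibre (\<phi> g \<omega>)"
  proof -
    have "\<phi> g ` \<phi> (inv g) ` B = B" if "B \<in> fibre (\<phi> g \<omega>)" for B
      using image_inv(2)[OF g fibre_block_subset[OF that]] .
    then have "(\<lambda>B. \<phi> g ` \<phi> (inv g) ` B) ` fibre (\<phi> g \<omega>) = fibre (\<phi> g \<omega>)" by simp
    then show ?thesis by (simp only: image_image[of "(`) (\<phi> g)"])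
  qed
  also have "\<dots> \<subseteq> (`) (\<phi> g) ` fibre \<omega>"
    using sub[of "inv g" "\<phi> g \<omega>"] g \<omega> orbit_sym_aux[OF g \<omega> refl] by (intro image_mono) auto
  finally show ?thesis using sub g by blast
qed

lemma fibre_eq_image: "\<omega> \<in> E \<Longrightarrow> \<exists>g\<in>carrier G. fibre \<omega> = (`) (\<phi> g) ` fibre \<pi>"
  using transitive[OF base_point] fibre_image[OF _ base_point] by metis

lemma Union_fibre: "\<Union> (fibre ` E) = \<B>"
  using base_point by (auto simp: fibre_def blocks) (use element_image in blast)+

lemma card_fibre:
  assumes "\<omega> \<in> E"
  shows "card (fibre \<omega>) = card (fibre \<pi>)"
proof -
  obtain g where g: "g \<in> carrier G" "fibre \<omega> = (`) (\<phi> g) ` fibre \<pi>"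
    using fibre_eq_image assms by blast
  moreover have "inj_on ((`) (\<phi> g)) (fibre \<pi>)"
    by (rule inj_on_inverseI[where g = "(`) (\<phi> (inv g))"])
      (rule image_inv(1)[OF g(1) fibre_block_subset])
  ultimately show ?thesis by (simp add: card_image)
qed

lemma card_blocks: "card \<B> = card E * card (fibre \<pi>)"
proof -
  have "card (\<Union>\<omega>\<in>E. fibre \<omega>) = (\<Sum>\<omega>\<in>E. card (fibre \<omega>))"
    using finite_E finite_subset[OF fibre_subset finite_blocks] fibre_disjoint
    by (intro card_UN_disjoint) auto
  moreover have "(\<Sum>\<omega>\<in>E. card (fibre \<omega>)) = card E * card (fibre \<pi>)"
    using card_fibre by simp
  ultimately show ?thesis using Union_fibre by simp
qed

lemma block_action_imprimitive:
  assumes "1 < card (fibre \<pi>)" "1 < card E"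
  shows "imprimitive_action G \<B> (block_action \<phi> \<B>)"
proof -
  have ne: "fibre \<omega> \<noteq> {}" if "\<omega> \<in> E" for \<omega>
    using card_fibre[OF that] assms by auto
  have "partition_on \<B> (fibre ` E)"
  proof (rule partition_onI)
    show "{} \<notin> fibre ` E" using ne by (metis imageE)
  qed (use Union_fibre fibre_disjoint in \<open>auto simp: disjnt_iff\<close>)
  moreover have "preserves_partition G (block_action \<phi> \<B>) (fibre ` E)"
  proof -
    have "block_action \<phi> \<B> g ` fibre \<omega> = fibre (\<phi> g \<omega>)" if "g \<in> carrier G" "\<omega> \<in> E" for g \<omega>
      unfolding fibre_image[OF that, symmetric] using fibre_subset[of \<omega>]
      by (intro image_cong) (auto simp: block_action_def)
    then show ?thesis
      unfolding preserves_partition_def using element_image by auto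
  qed
  moreover have "\<not> trivial_partition \<B> (fibre ` E)"
  proof
    assume "trivial_partition \<B> (fibre ` E)"
    moreover have "fibre \<pi> \<noteq> \<B>"
      using card_blocks assms by auto
    moreover have "fibre \<pi> \<noteq> {B}" for B
      using assms by auto
    ultimately show False using base_point unfolding trivial_partition_def by blast
  qed
  ultimately show ?thesis
    using block_action_transitive unfolding imprimitive_action_def primitive_action_def by blast
qed

end

section \<open>The Suzuki group and its Bruhat decomposition\<close>

lemma group_GL4: "group (GL4 :: ('f::field^4^4) monoid)"
proof (rule groupI)
  fix x :: "'f^4^4" assume "x \<in> carrier GL4"
  then obtain y where "x ** y = mat 1" "y ** x = mat 1"
    by (auto simp: GL4_def invertible_def)
  then show "\<exists>y\<in>carrier GL4. y \<otimes>\<^bsub>GL4\<^esub> x = \<one>\<^bsub>GL4\<^esub>"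
    by (auto simp: GL4_def invertible_def)
qed (auto simp: GL4_def invertible_mult matrix_mul_assoc invertible_def[of "mat 1"])

lemma group_opposite_group:
  assumes "group G"
  shows "group (opposite_group G)"
proof -
  interpret group G by fact
  show ?thesis
    by (rule groupI) (auto simp: opposite_group_def m_assoc intro!: bexI[of _ "inv\<^bsub>G\<^esub> _"])
qed

lemma opposite_group_simps [simp]:
  "carrier (opposite_group G) = carrier G"
  "x \<otimes>\<^bsub>opposite_group G\<^esub> y = y \<otimes>\<^bsub>G\<^esub> x"
  "\<one>\<^bsub>opposite_group G\<^esub> = \<one>\<^bsub>G\<^esub>"
  by (simp_all add: opposite_group_def)

lemma proj_image_mult: "proj_image (g ** h) U = proj_image h (proj_image g U)"
  by (simp add: proj_image_def image_image vector_matrix_mul_assoc)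

lemma proj_image_one [simp]: "proj_image (mat 1) U = U"
  by (simp add: proj_image_def)

lemma proj_image_proj_point: "proj_image g (proj_point w) = proj_point (w v* g)"
  by (simp add: proj_image_def proj_point_def vec.span_singleton image_image
      flip: scalar_vector_matrix_assoc)

lemma proj_point_scale:
  assumes "c \<noteq> 0"
  shows "proj_point (c *s w) = proj_point w"
  unfolding proj_point_def
proof -
  have "c *s w \<in> vec.span {w}" by (simp add: vec.span_base vec.span_scale)
  moreover have "inverse c *s (c *s w) \<in> vec.span {c *s w}" by (intro vec.span_scale vec.span_base) simp
  then have "w \<in> vec.span {c *s w}" using assms by (simp add: vector_smult_assoc)
  ultimately show "vec.span {c *s w} = vec.span {w}" by (simp add: vec.span_eq)
qed

context suzuki_field
begin

definition gens :: "('f^4^4) set" where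
  "gens = {s x y | x y. True} \<union> {m k | k. k \<noteq> 0} \<union> {\<tau>}"

abbreviation G :: "('f^4^4) monoid" where "G \<equiv> Sz n"

lemma Sz_simps [simp]:
  "g \<otimes>\<^bsub>G\<^esub> h = g ** h" "\<one>\<^bsub>G\<^esub> = mat 1"
  by (simp_all add: Sz_def GL4_def)

lemma carrier_Sz: "carrier G = generate GL4 gens"
  by (simp_all add: Sz_def GL4_def gens_def)

lemma gens_inverse:
  assumes "g \<in> gens"
  shows "\<exists>h\<in>gens. g ** h = mat 1 \<and> h ** g = mat 1"
proof -
  consider x y where "g = s x y" | k where "k \<noteq> 0" "g = m k" | "g = \<tau>"
    using assms by (auto simp: gens_def)
  then show ?thesis
  proof cases
    case 1
    then show ?thesis
      by (intro bexI[of _ "s x (y + x * \<theta> x)"]) (auto simp: s_s s_0 gens_def ac_simps)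
  next
    case 2
    then show ?thesis
      by (intro bexI[of _ "m (inverse k)"]) (auto simp: m_m m_1 gens_def)
  next
    case 3
    then show ?thesis by (intro bexI[of _ \<tau>]) (auto simp: tau_tau gens_def)
  qed
qed

lemma gens_subset: "gens \<subseteq> carrier GL4"
  using gens_inverse by (auto simp: GL4_def invertible_def)

lemma inv_gens: "g \<in> gens \<Longrightarrow> inv\<^bsub>GL4\<^esub> g \<in> gens"
proof -
  assume g: "g \<in> gens"
  then obtain h where h: "h \<in> gens" "h ** g = mat 1" using gens_inverse by blast
  have "inv\<^bsub>GL4\<^esub> g = h"
    using group.inv_equality[OF group_GL4, of h g] g h gens_subset by (auto simp: GL4_def)
  then show ?thesis using h by simp
qed

lemma group_Sz: "group G"
  unfolding Sz_def gens_def[symmetric]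
  using group.subgroup_imp_group[OF group_GL4 group.generate_is_subgroup[OF group_GL4 gens_subset]] .

lemma Sz_induct [consumes 1, case_names one mult]:
  assumes g: "g \<in> carrier G"
    and one: "Q (mat 1)"
    and mult: "\<And>g h. g \<in> carrier G \<Longrightarrow> Q g \<Longrightarrow> h \<in> gens \<Longrightarrow> Q (g ** h)"
  shows "Q g"
proof -
  have "\<forall>x\<in>carrier G. Q x \<longrightarrow> Q (x ** g)" if "g \<in> generate GL4 gens" for g
    using that
  proof induction
    case one
    then show ?case by (simp add: GL4_def)
  next
    case (incl h)
    then show ?case using mult by simp
  next
    case (inv h)
    then show ?case using mult inv_gens by simp
  next
    case (eng h1 h2)
    have "x ** h1 \<in> carrier G" if "x \<in> carrier G" for x
      using generate.eng[OF that[unfolded carrier_Sz] eng(1)] by (simp add: carrier_Sz GL4_def)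
    then show ?case using eng by (simp add: GL4_def matrix_mul_assoc)
  qed
  moreover have "mat 1 \<in> generate GL4 gens"
    using generate.one[of GL4 gens] by (simp add: GL4_def)
  ultimately show ?thesis using g one by (metis carrier_Sz matrix_mul_lid)
qed

lemma gens_carrier: "g \<in> gens \<Longrightarrow> g \<in> carrier G"
  by (simp add: carrier_Sz generate.incl)

lemma mult_carrier: "g \<in> carrier G \<Longrightarrow> h \<in> carrier G \<Longrightarrow> g ** h \<in> carrier G"
  using group.is_monoid[OF group_Sz] monoid.m_closed by fastforce

lemma s_carrier: "s x y \<in> carrier G"
  by (rule gens_carrier) (auto simp: gens_def)

lemma m_carrier: "k \<noteq> 0 \<Longrightarrow> m k \<in> carrier G"
  by (rule gens_carrier) (auto simp: gens_def)

lemma tau_carrier: "\<tau> \<in> carrier G"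
  by (rule gens_carrier) (auto simp: gens_def)

definition small_cell :: "('f^4^4) set" where
  "small_cell = {m k ** s x y | k x y. k \<noteq> 0}"

lemma small_cellI: "k \<noteq> 0 \<Longrightarrow> m k ** s x y \<in> small_cell"
  by (auto simp: small_cell_def)

lemma small_cellE:
  assumes "g \<in> small_cell"
  obtains k x y where "k \<noteq> 0" "g = m k ** s x y"
  using assms by (auto simp: small_cell_def)

lemma small_cell_s: "g \<in> small_cell \<Longrightarrow> g ** s x y \<in> small_cell"
  by (metis small_cellE small_cellI matrix_mul_assoc s_s)

lemma small_cell_m:
  assumes "g \<in> small_cell" "k \<noteq> 0"
  shows "g ** m k \<in> small_cell"
proof -
  obtain k' x y where g: "k' \<noteq> 0" "g = m k' ** s x y" using assms(1) by (rule small_cellE)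
  then have "g ** m k = m k' ** (s x y ** m k)" by (simp add: matrix_mul_assoc)
  also have "\<dots> = m (k' * k) ** s (k * x) (k * \<theta> k * y)"
    by (simp add: s_m[OF assms(2)] matrix_mul_assoc m_m)
  finally show ?thesis using g assms by (simp add: small_cellI)
qed

definition big_cell :: "('f^4^4) set" where
  "big_cell = {g ** \<tau> ** s x y | g x y. g \<in> small_cell}"

lemma big_cellI: "g \<in> small_cell \<Longrightarrow> g ** \<tau> ** s x y \<in> big_cell"
  by (auto simp: big_cell_def)

lemma big_cell_s: "g \<in> big_cell \<Longrightarrow> g ** s x y \<in> big_cell"
  unfolding big_cell_def using s_s by (auto simp flip: matrix_mul_assoc) metis

lemma big_cell_m:
  assumes "g \<in> big_cell" "k \<noteq> 0"
  shows "g ** m k \<in> big_cell"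
proof -
  obtain h x y where h: "h \<in> small_cell" "g = h ** \<tau> ** s x y"
    using assms(1) by (auto simp: big_cell_def)
  have "g ** m k = h ** (\<tau> ** m (inverse (inverse k))) ** s (k * x) (k * \<theta> k * y)"
    using s_m[OF assms(2)] by (simp add: h matrix_mul_assoc[symmetric])
  also have "\<tau> ** m (inverse (inverse k)) = m (inverse k) ** \<tau>"
    using m_tau[of "inverse k"] assms by simp
  finally have "g ** m k = (h ** m (inverse k)) ** \<tau> ** s (k * x) (k * \<theta> k * y)"
    by (simp add: matrix_mul_assoc)
  then show ?thesis using small_cell_m h assms by (simp add: big_cellI)
qed

lemma small_cell_tau: "g \<in> small_cell \<Longrightarrow> g ** \<tau> \<in> big_cell"
  using big_cellI[of g 0 0] by (simp add: s_0)

lemma big_cell_tau: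
  assumes "g \<in> big_cell"
  shows "g ** \<tau> \<in> small_cell \<union> big_cell"
proof -
  obtain h x y where h: "h \<in> small_cell" "g = h ** \<tau> ** s x y"
    using assms by (auto simp: big_cell_def)
  then have g: "g ** \<tau> = h ** (\<tau> ** s x y ** \<tau>)" by (simp add: matrix_mul_assoc)
  show ?thesis
  proof (cases "N x y = 0")
    case True
    then show ?thesis using g h by (simp add: s_0 tau_tau)
  next
    case False
    obtain x1 y1 k x2 y2 where "k \<noteq> 0" "\<tau> ** s x y ** \<tau> = s x1 y1 ** m k ** \<tau> ** s x2 y2"
      using tau_s_tau[OF False] False by (metis divide_eq_0_iff power_not_zero theta_simps(8))
    then have "g ** \<tau> = (h ** s x1 y1 ** m k) ** \<tau> ** s x2 y2" "h ** s x1 y1 ** m k \<in> small_cell"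
      using g h small_cell_m small_cell_s by (simp_all add: matrix_mul_assoc)
    then show ?thesis using big_cellI by simp
  qed
qed

theorem Sz_bruhat: "g \<in> carrier G \<Longrightarrow> g \<in> small_cell \<union> big_cell"
proof (induction rule: Sz_induct)
  case one
  have "mat 1 = m 1 ** s 0 0" by (simp add: m_1 s_0)
  then show ?case using small_cellI[of 1 0 0] by simp
next
  case (mult g h)
  from mult.hyps(2) consider x y where "h = s x y" | k where "k \<noteq> 0" "h = m k" | "h = \<tau>"
    by (auto simp: gens_def)
  then show ?case
    using mult.IH small_cell_s small_cell_m big_cell_s big_cell_m small_cell_tau big_cell_tau[of g] by cases auto
qed

section \<open>The action on the ovoid\<close>

abbreviation pt :: "'f \<Rightarrow> 'f \<Rightarrow> ('f^4) set" where "pt \<equiv> ovoid_point n"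
abbreviation pinf :: "('f^4) set" where "pinf \<equiv> ovoid_infinity"
abbreviation E :: "('f^4) set set" where "E \<equiv> ovoid n"

lemma pt_def: "pt a b = proj_point (vector [N a b, b, a, 1])"
  by (simp add: ovoid_point_def tits_form_def)

lemma pt_eq_iff [simp]: "pt a b = pt c d \<longleftrightarrow> a = c \<and> b = d"
proof
  assume *: "pt a b = pt c d"
  have "vector [N a b, b, a, 1] \<in> pt a b"
    by (simp add: pt_def proj_point_def vec.span_base)
  then obtain k where "vector [N a b, b, a, 1] = k *s (vector [N c d, d, c, 1] :: 'f^4)"
    unfolding * by (auto simp: pt_def proj_point_def vec.span_singleton)
  then show "a = c \<and> b = d" by (simp add: vec_eq_iff forall_4)
qed simp

lemma pt_neq_inf [simp]: "pt a b \<noteq> pinf" "pinf \<noteq> pt a b"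
proof -
  have "vector [N a b, b, a, 1] \<in> pt a b"
    by (simp add: pt_def proj_point_def vec.span_base)
  moreover have "vector [N a b, b, a, 1] \<notin> pinf"
    by (auto simp: ovoid_infinity_def proj_point_def vec.span_singleton vec_eq_iff forall_4)
  ultimately show "pt a b \<noteq> pinf" "pinf \<noteq> pt a b" by auto
qed

lemma pt_in_ovoid [simp]: "pt a b \<in> E" and inf_in_ovoid [simp]: "pinf \<in> E"
  by (auto simp: ovoid_def)

lemma ovoid_cases [consumes 1, case_names pinf pt]:
  assumes "\<omega> \<in> E"
  obtains "\<omega> = pinf" | a b where "\<omega> = pt a b"
  using assms by (auto simp: ovoid_def)

lemma proj_image_s [simp]:
  "proj_image (s x y) (pt a b) = pt (a + x) (b + y + (a + x) * \<theta> x)"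
  "proj_image (s x y) pinf = pinf"
  unfolding pt_def ovoid_infinity_def proj_image_proj_point N_translate
  by (rule arg_cong[where f = proj_point];
      simp add: Sz_s_vector vec_eq_iff forall_4 vector_matrix_mult_def sum_4 algebra_simps)+

lemma proj_image_m [simp]:
  assumes "k \<noteq> 0"
  shows "proj_image (m k) (pt a b) = pt (k * a) (k * \<theta> k * b)"
    and "proj_image (m k) pinf = pinf"
proof -
  have \<theta>: "\<theta> k = \<rho> k * \<rho> k" by (simp add: power2_eq_square flip: rho_square)
  have "(k * \<rho> k) *s (vector [N a b, b, a, 1] v* m k)
      = vector [N (k * a) (k * \<theta> k * b), k * \<theta> k * b, k * a, 1]"
    unfolding N_scale using assms
    by (simp add: \<theta> Sz_m_vector vec_eq_iff forall_4 vector_matrix_mult_def sum_4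
        power2_eq_square divide_simps)
  then show "proj_image (m k) (pt a b) = pt (k * a) (k * \<theta> k * b)"
    unfolding pt_def proj_image_proj_point using assms proj_point_scale
    by (metis mult_eq_0_iff rho_simps(7))
  have "vector [1, 0, 0, 0] v* m k = (k * \<rho> k) *s vector [1, 0, 0, 0]"
    by (simp add: Sz_m_vector vec_eq_iff forall_4 vector_matrix_mult_def sum_4)
  then show "proj_image (m k) pinf = pinf"
    unfolding ovoid_infinity_def proj_image_proj_point using assms proj_point_scale
    by (metis mult_eq_0_iff rho_simps(7))
qed

lemma proj_image_tau:
  "proj_image \<tau> (pt a b) = (if a = 0 \<and> b = 0 then pinf else pt (b / N a b) (a / N a b))"
  "proj_image \<tau> pinf = pt 0 0"
proof -
  have *: "vector [x, y, z, w] v* \<tau> = vector [w, z, y, x :: 'f]" for x y z w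
    by (simp add: Sz_tau_vector vec_eq_iff forall_4 vector_matrix_mult_def sum_4)
  have "proj_image \<tau> (pt a b) = pt (b / N a b) (a / N a b)" if "N a b \<noteq> 0"
  proof -
    have "vector [1, a, b, N a b] = N a b *s (vector [N (b / N a b) (a / N a b), a / N a b, b / N a b, 1] :: 'f^4)"
      using that by (simp only: N_invert[OF that]) (simp add: vec_eq_iff forall_4)
    then show ?thesis
      unfolding pt_def proj_image_proj_point * using proj_point_scale[OF that] by simp
  qed
  then show "proj_image \<tau> (pt a b) = (if a = 0 \<and> b = 0 then pinf else pt (b / N a b) (a / N a b))"
    by (auto simp: pt_def ovoid_infinity_def proj_image_proj_point *)
  show "proj_image \<tau> pinf = pt 0 0"
    by (simp add: pt_def ovoid_infinity_def proj_image_proj_point *)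
qed

lemma proj_image_ovoid:
  assumes "g \<in> carrier G" "\<omega> \<in> E"
  shows "proj_image g \<omega> \<in> E"
  using assms
proof (induction arbitrary: \<omega> rule: Sz_induct)
  case (mult g h)
  have "proj_image h \<omega> \<in> E" if "\<omega> \<in> E" for \<omega>
    using that mult.hyps(2)
    by (cases rule: ovoid_cases) (auto simp: gens_def proj_image_tau)
  then show ?case using mult by (simp add: proj_image_mult)
qed simp

abbreviation Gop :: "('f^4^4) monoid" where "Gop \<equiv> opposite_group (Sz n)"
abbreviation \<phi> :: "'f^4^4 \<Rightarrow> ('f^4) set \<Rightarrow> ('f^4) set" where "\<phi> \<equiv> ovoid_action n"

lemma phi_eq: "\<omega> \<in> E \<Longrightarrow> \<phi> g \<omega> = proj_image g \<omega>"
  by (simp add: ovoid_action_def)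

lemma phi_image: "B \<subseteq> E \<Longrightarrow> \<phi> g ` B = proj_image g ` B"
  by (rule image_cong) (auto simp: phi_eq)

lemma group_action_ovoid: "group_action Gop E \<phi>"
proof (rule group_actionI)
  show "group Gop" using group_Sz by (rule group_opposite_group)
  fix g assume "g \<in> carrier Gop"
  then have g: "g \<in> carrier G" by (simp only: opposite_group_simps)
  define h where "h = inv\<^bsub>G\<^esub> g"
  have "h \<in> carrier G" "g ** h = mat 1" "h ** g = mat 1"
    using group.inv_closed[OF group_Sz g] group.r_inv[OF group_Sz g] group.l_inv[OF group_Sz g]
    unfolding h_def Sz_simps(1,2) by auto
  then have "bij_betw (\<phi> g) E E"
    using g proj_image_ovoid
    by (intro bij_betwI[where g = "\<phi> h"]) (auto simp: phi_eq simp flip: proj_image_mult)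
  then show "\<phi> g \<in> Bij E" by (simp add: Bij_def ovoid_action_def)
next
  fix g h \<omega> assume "g \<in> carrier Gop" "h \<in> carrier Gop" "\<omega> \<in> E"
  then show "\<phi> (g \<otimes>\<^bsub>Gop\<^esub> h) \<omega> = \<phi> g (\<phi> h \<omega>)"
    using proj_image_ovoid by (simp add: phi_eq proj_image_mult)
qed

sublocale ovoid: group_action Gop E \<phi>
  by (rule group_action_ovoid)

lemma proj_image_small_cell:
  assumes "k \<noteq> 0"
  shows "proj_image (m k ** s x y) pinf = pinf"
    and "proj_image (m k ** s x y) (pt a b) = pt (k * a + x) (k * \<theta> k * b + y + (k * a + x) * \<theta> x)"
  using assms by (simp_all add: proj_image_mult)

lemma stabilizer_pinf:
  assumes g: "g \<in> carrier G" "proj_image g pinf = pinf"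
  shows "g \<in> small_cell"
proof (rule ccontr)
  assume "g \<notin> small_cell"
  then have "g \<in> big_cell" using Sz_bruhat[OF g(1)] by simp
  then obtain k x y x' y' where "k \<noteq> 0" "g = m k ** s x y ** \<tau> ** s x' y'"
    by (auto simp: big_cell_def small_cell_def)
  then show False
    using g(2) by (simp add: proj_image_mult[of "m k ** s x y ** \<tau>"]
        proj_image_mult[of "m k ** s x y"] proj_image_small_cell proj_image_tau)
qed

lemma faithful_action_ovoid: "faithful_action Gop E \<phi>"
proof -
  interpret group_hom Gop "BijGroup E" \<phi> by (rule ovoid.group_hom)
  have "g = mat 1" if g: "g \<in> carrier G" and \<phi>: "\<phi> g = \<phi> (mat 1)" for g
  proof -
    have fixed: "proj_image g \<omega> = \<omega>" if "\<omega> \<in> E" for \<omega>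
      using fun_cong[OF \<phi>, of \<omega>] that by (simp add: phi_eq)
    then obtain k x y where k: "k \<noteq> 0" "g = m k ** s x y"
      using stabilizer_pinf[OF g] by (auto simp: small_cell_def)
    have "x = 0 \<and> y = 0"
      using fixed[of "pt 0 0"] k by (simp add: proj_image_small_cell)
    moreover from this have "k = 1"
      using fixed[of "pt 1 0"] k by (simp add: proj_image_small_cell)
    ultimately show ?thesis using k by (simp add: m_1 s_0)
  qed
  then have "inj_on \<phi> (carrier Gop)"
    unfolding inj_on_one_iff using hom_one by simp
  then show ?thesis by unfold_locales
qed

lemma move_to_origin: "\<exists>x y. proj_image (s x y) (pt a b) = pt 0 0"
  by (intro exI[of _ a] exI[of _ b]) simp

lemma doubly_transitive_ovoid: "doubly_transitive Gop E \<phi>"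
proof (rule ovoid.doubly_transitiveI[of pinf "pt 0 0"])
  fix \<omega> assume \<omega>: "\<omega> \<in> E"
  show "\<exists>g\<in>carrier Gop. \<phi> g \<omega> = pinf"
    using \<omega>
  proof (cases rule: ovoid_cases)
    case pinf
    then have "\<phi> (s 0 0) \<omega> = pinf" by (simp add: phi_eq)
    then show ?thesis using s_carrier unfolding opposite_group_simps by blast
  next
    case (pt a b)
    obtain x y where "proj_image (s x y) (pt a b) = pt 0 0" using move_to_origin by blast
    then have "\<phi> (s x y ** \<tau>) \<omega> = pinf"
      using pt by (simp add: phi_eq proj_image_mult proj_image_tau)
    then show ?thesis
      using mult_carrier[OF s_carrier tau_carrier] unfolding opposite_group_simps by blast
  qed
  assume "\<omega> \<noteq> pinf"
  with \<omega> obtain a b where \<omega>_eq: "\<omega> = pt a b" by (auto elim: ovoid_cases)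
  obtain x y where "proj_image (s x y) (pt a b) = pt 0 0" using move_to_origin by blast
  then have "\<phi> (s x y) pinf = pinf" "\<phi> (s x y) \<omega> = pt 0 0" by (simp_all add: phi_eq \<omega>_eq)
  then show "\<exists>g\<in>carrier Gop. \<phi> g pinf = pinf \<and> \<phi> g \<omega> = pt 0 0"
    using s_carrier unfolding opposite_group_simps by blast
qed simp_all

lemma card_ovoid: "card E = CARD('f)^2 + 1"
proof -
  have "E = insert pinf (range (\<lambda>(a, b). pt a b))"
    by (auto simp: ovoid_def)
  moreover have "card (range (\<lambda>(a, b). pt a b)) = CARD('f)^2"
    by (subst card_image) (auto intro!: inj_onI simp: power2_eq_square)
  ultimately show ?thesis by (auto simp: card_insert_if)
qed

section \<open>Classes and circles\<close>

definition cls :: "'f \<Rightarrow> ('f^4) set set" where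
  "cls c = range (pt c)"

lemma pt_in_cls [simp]: "pt a b \<in> cls c \<longleftrightarrow> a = c" and pinf_notin_cls [simp]: "pinf \<notin> cls c"
  by (auto simp: cls_def)

lemma cls_subset: "cls c \<subseteq> E"
  by (auto simp: cls_def)

lemma card_cls: "card (cls c) = CARD('f)"
  unfolding cls_def by (subst card_image) (auto intro: inj_onI)

lemma cls_eq_iff: "cls c = cls d \<longleftrightarrow> c = d"
  by (metis pt_in_cls)

lemma Delta2_eq: "Delta2 n = cls 0"
  by (auto simp: Delta2_def cls_def)

lemma Delta3_eq: "Delta3 n = E - insert pinf (cls (0::'f))"
  by (auto simp: Delta3_def elim!: ovoid_cases)

lemma proj_image_cls:
  assumes "k \<noteq> 0"
  shows "proj_image (m k ** s x y) ` cls c = cls (k * c + x)"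
proof -
  have "b \<in> range (\<lambda>b. k * \<theta> k * b + d)" for b d
    using assms by (intro image_eqI[of _ _ "(b + d) / (k * \<theta> k)"]) (auto simp: add.assoc)
  then have "range (\<lambda>b. k * \<theta> k * b + y + (k * c + x) * \<theta> x) = UNIV"
    by (auto simp: add.assoc)
  then have "range (pt (k * c + x) \<circ> (\<lambda>b. k * \<theta> k * b + y + (k * c + x) * \<theta> x)) = cls (k * c + x)"
    unfolding cls_def by (metis image_comp)
  then show ?thesis
    using assms by (simp add: cls_def image_image proj_image_small_cell comp_def)
qed

lemma tau_cls: "proj_image \<tau> ` cls c \<noteq> cls a"
proof
  assume *: "proj_image \<tau> ` cls c = cls a"
  have in_cls: "proj_image \<tau> (pt c b) \<in> cls a" for b
    unfolding *[symmetric] by simp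
  show False
  proof (cases "c = 0")
    case True
    then show False using in_cls[of 0] by (simp add: proj_image_tau)
  next
    case False
    then show False using in_cls[of 0] in_cls[of 1] by (auto simp: proj_image_tau)
  qed
qed

lemma tau_circle: "proj_image \<tau> ` insert pinf (cls c) \<noteq> insert pinf (cls a)"
proof
  assume *: "proj_image \<tau> ` insert pinf (cls c) = insert pinf (cls a)"
  have "pt 0 0 \<in> proj_image \<tau> ` insert pinf (cls c)"
    by (auto simp: proj_image_tau)
  then have a: "a = 0" unfolding * by auto
  have "pinf \<in> proj_image \<tau> ` insert pinf (cls c)"
    unfolding * by simp
  then have c: "c = 0" by (auto simp: cls_def proj_image_tau split: if_splits)
  have "proj_image \<tau> (pt 0 1) \<in> proj_image \<tau> ` insert pinf (cls c)"
    by (simp add: c)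
  then show False unfolding * by (simp add: proj_image_tau a)
qed

text \<open>
  Applied to the classes and to the circles, both of which \<open>small_cell\<close> permutes and \<open>\<tau>\<close> never
  preserves, this rules out the big cell in the set stabiliser of a base block.
\<close>

lemma stabilizer_fixes_pinf:
  assumes D: "\<And>k x y c. k \<noteq> 0 \<Longrightarrow> proj_image (m k ** s x y) ` D c = D (k * c + x)"
    and tau: "\<And>c a. proj_image \<tau> ` D c \<noteq> D a"
    and g: "g \<in> carrier G" "proj_image g ` D c = D c"
  shows "proj_image g pinf = pinf"
proof -
  have "g \<notin> big_cell"
  proof
    assume "g \<in> big_cell"
    then obtain k x y x' y' where k: "k \<noteq> 0" "g = m k ** s x y ** \<tau> ** s x' y'"
      by (auto simp: big_cell_def small_cell_def)
    have s: "proj_image (s u v) ` D a = D (a + u)" for u v a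
      using D[of 1 u v a] by (simp add: m_1)
    have img: "proj_image (g ** h) ` B = proj_image h ` proj_image g ` B" for g h B
      by (simp add: image_image proj_image_mult)
    obtain y'' where inv: "s x' y' ** s x' y'' = mat 1"
      using s_s[of x' y' x' "y' + x' * \<theta> x'"] by (metis add_self s_0 add.assoc)
    have "proj_image \<tau> ` D (k * c + x) = proj_image (g ** s x' y'') ` D c"
      using inv D[OF k(1)] unfolding k(2) by (simp add: img flip: matrix_mul_assoc)
    also have "\<dots> = D (c + x')" using g(2) s by (simp add: img)
    finally show False using tau by simp
  qed
  then have "g \<in> small_cell" using Sz_bruhat[OF g(1)] by simp
  then show ?thesis by (auto elim!: small_cellE simp: proj_image_small_cell)
qed

lemma phi_Diff:
  assumes "g \<in> carrier G" "A \<subseteq> E"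
  shows "\<phi> g ` (E - A) = E - proj_image g ` A"
  using inj_on_image_set_diff[OF ovoid.inj_prop[of g], of E A] ovoid.surj_prop[of g] assms
  by (simp add: phi_image)

lemma set_orbit_eq:
  assumes "\<Delta> \<subseteq> E"
  shows "set_orbit n \<Delta> = {\<phi> g ` \<Delta> | g. g \<in> carrier Gop}"
  unfolding set_orbit_def orbit_def opposite_group_simps phi_image[OF assms] ..

lemma pointed_orbit_designI:
  assumes "\<Delta> \<subseteq> E"
    and "\<And>g. g \<in> carrier G \<Longrightarrow> \<phi> g ` \<Delta> = \<Delta> \<Longrightarrow> proj_image g pinf = pinf"
  shows "pointed_orbit_design Gop E \<phi> \<Delta> (set_orbit n \<Delta>) pinf"
proof unfold_locales
  show "finite E" using card_ovoid by (auto intro: card_ge_0_finite)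
  fix x y assume "x \<in> E" "y \<in> E"
  then show "\<exists>g\<in>carrier Gop. \<phi> g x = y"
    by (rule ovoid.doubly_transitive_imp_transitive[OF doubly_transitive_ovoid])
next
  fix g assume "g \<in> carrier Gop" "\<phi> g ` \<Delta> = \<Delta>"
  then show "\<phi> g pinf = pinf"
    using assms(2) by (simp add: phi_eq)
qed (use assms set_orbit_eq in simp_all)

lemma fibre_eq:
  assumes "pointed_orbit_design Gop E \<phi> \<Delta> (set_orbit n \<Delta>) pinf"
    and D: "\<And>k x y. k \<noteq> 0 \<Longrightarrow> \<phi> (m k ** s x y) ` \<Delta> = D x"
  shows "pointed_orbit_design.fibre Gop \<phi> \<Delta> pinf pinf = range D"
proof -
  interpret pointed_orbit_design Gop E \<phi> \<Delta> "set_orbit n \<Delta>" pinf by fact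
  show ?thesis
  proof (intro equalityI subsetI)
    fix B assume "B \<in> fibre pinf"
    then obtain g where g: "g \<in> carrier G" "\<phi> g pinf = pinf" "B = \<phi> g ` \<Delta>"
      unfolding fibre_def opposite_group_simps by blast
    then have "g \<in> small_cell" using stabilizer_pinf by (simp add: phi_eq)
    then show "B \<in> range D" using D g by (auto elim!: small_cellE)
  next
    fix B assume "B \<in> range D"
    then obtain x where "B = \<phi> (m 1 ** s x 0) ` \<Delta>" using D[of 1] by auto
    moreover have "\<phi> (m 1 ** s x 0) pinf = pinf"
      by (simp add: phi_eq proj_image_small_cell)
    moreover have "m 1 ** s x 0 \<in> carrier Gop"
      unfolding opposite_group_simps by (intro mult_carrier m_carrier s_carrier) simp
    ultimately show "B \<in> fibre pinf" unfolding fibre_def by blast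
  qed
qed

lemma design_of_block:
  fixes \<Delta>
  defines "\<B> \<equiv> set_orbit n \<Delta>" and "q \<equiv> CARD('f)"
  assumes design: "pointed_orbit_design Gop E \<phi> \<Delta> \<B> pinf"
    and D: "\<And>k x y. k \<noteq> 0 \<Longrightarrow> \<phi> (m k ** s x y) ` \<Delta> = D x" and "inj D"
    and flag: "\<And>\<omega> \<omega>'. \<omega> \<in> \<Delta> \<Longrightarrow> \<omega>' \<in> \<Delta> \<Longrightarrow> \<exists>k y. k \<noteq> 0 \<and> \<phi> (m k ** s 0 y) \<omega> = \<omega>'"
    and k: "card \<Delta> = k" and l: "k * (k - 1) = q * l" and r: "q * k = r"
  shows "two_design E \<B> (q^2 + 1) k l \<and> has_replication_number E \<B> k r \<and>
    design_automorphism_group Gop \<phi> E \<B> \<and> flag_transitive Gop \<phi> E \<B> \<and>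
    primitive_action Gop E \<phi> \<and> imprimitive_action Gop \<B> (block_action \<phi> \<B>)"
proof -
  interpret pointed_orbit_design Gop E \<phi> \<Delta> \<B> pinf by fact
  have q: "q > 1"
    unfolding q_def card_field by (rule one_less_power) simp_all
  have fibre: "card (fibre pinf) = q"
    using fibre_eq[OF design[unfolded \<B>_def] D] card_image[OF \<open>inj D\<close>] by (simp add: q_def)
  have b: "card \<B> = (q^2 + 1) * q"
    using card_blocks card_ovoid fibre by (simp add: q_def)
  have D0: "\<Delta> = D 0"
    using D[of 1 0 0] ovoid.image_one[OF Delta_subset] by (simp add: m_1 s_0)
  have "card \<B> * (k * (k - 1)) = (q^2 + 1) * (q^2 + 1 - 1) * l"
    unfolding b l by (simp add: power2_eq_square algebra_simps)
  then have "two_design E \<B> (q^2 + 1) k l"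
    using card_ovoid k q by (intro two_designI[OF doubly_transitive_ovoid]) (simp_all add: q_def)
  moreover have "has_replication_number E \<B> k r"
  proof (rule has_replication_numberI[OF doubly_transitive_ovoid])
    show "card \<B> * k = (q^2 + 1) * r" by (simp only: b mult.assoc flip: r)
  qed (use card_ovoid k in \<open>simp_all add: q_def\<close>)
  moreover have "flag_transitive Gop \<phi> E \<B>"
  proof (rule flag_transitiveI)
    fix \<omega> \<omega>' assume "\<omega> \<in> \<Delta>" "\<omega>' \<in> \<Delta>"
    then obtain k y where "k \<noteq> 0" "\<phi> (m k ** s 0 y) \<omega> = \<omega>'" using flag by blast
    moreover from this have "m k ** s 0 y \<in> carrier Gop"
      unfolding opposite_group_simps by (intro mult_carrier m_carrier s_carrier)
    ultimately show "\<exists>g\<in>carrier Gop. \<phi> g ` \<Delta> = \<Delta> \<and> \<phi> g \<omega> = \<omega>'"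
      using D D0 by metis
  qed
  moreover have "imprimitive_action Gop \<B> (block_action \<phi> \<B>)"
    using block_action_imprimitive fibre q card_ovoid by (simp add: q_def)
  ultimately show ?thesis
    using design_automorphism_groupI[OF faithful_action_ovoid]
      ovoid.doubly_transitive_imp_primitive[OF doubly_transitive_ovoid] by simp
qed

lemma Delta2_design:
  fixes \<B> :: "('f^4) set set set"
  defines "\<B> \<equiv> set_orbit n (Delta2 n)" and "q \<equiv> CARD('f)"
  shows "two_design E \<B> (q^2 + 1) q (q - 1) \<and> has_replication_number E \<B> q (q^2) \<and>
    design_automorphism_group Gop \<phi> E \<B> \<and> flag_transitive Gop \<phi> E \<B> \<and>
    primitive_action Gop E \<phi> \<and> imprimitive_action Gop \<B> (block_action \<phi> \<B>)"
  unfolding \<B>_def q_def Delta2_eq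
proof (rule design_of_block)
  show "pointed_orbit_design Gop E \<phi> (cls 0) (set_orbit n (cls 0)) pinf"
    using stabilizer_fixes_pinf[OF proj_image_cls tau_cls]
    by (intro pointed_orbit_designI cls_subset) (auto simp: phi_image cls_subset)
  show "\<phi> (m k ** s x y) ` cls 0 = cls x" if "k \<noteq> 0" for k x y
    using proj_image_cls[OF that] by (simp add: phi_image cls_subset)
  show "inj cls" by (simp add: inj_def cls_eq_iff)
  fix \<omega> \<omega>' assume "\<omega> \<in> cls 0" "\<omega>' \<in> cls 0"
  then obtain b b' where "\<omega> = pt 0 b" "\<omega>' = pt 0 b'" by (auto simp: cls_def)
  then show "\<exists>k y. k \<noteq> 0 \<and> \<phi> (m k ** s 0 y) \<omega> = \<omega>'"
    by (intro exI[of _ 1] exI[of _ "b + b'"]) (simp add: phi_eq proj_image_small_cell)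
qed (simp_all add: card_cls power2_eq_square)

lemma Delta3_design:
  fixes \<B> :: "('f^4) set set set"
  defines "\<B> \<equiv> set_orbit n (Delta3 n)" and "q \<equiv> CARD('f)"
  shows "two_design E \<B> (q^2 + 1) (q * (q - 1)) ((q - 1) * (q^2 - q - 1)) \<and>
    has_replication_number E \<B> (q * (q - 1)) (q^2 * (q - 1)) \<and>
    design_automorphism_group Gop \<phi> E \<B> \<and> flag_transitive Gop \<phi> E \<B> \<and>
    primitive_action Gop E \<phi> \<and> imprimitive_action Gop \<B> (block_action \<phi> \<B>)"
  unfolding \<B>_def q_def Delta3_eq
proof (rule design_of_block)
  let ?C = "\<lambda>c. insert pinf (cls c)" and ?q = "CARD('f)"
  have C: "?C c \<subseteq> E" for c using cls_subset by simp
  have circle: "proj_image (m k ** s x y) ` ?C c = ?C (k * c + x)" if "k \<noteq> 0" for k x y c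
    using that by (simp add: proj_image_cls proj_image_small_cell)
  show "pointed_orbit_design Gop E \<phi> (E - ?C 0) (set_orbit n (E - ?C 0)) pinf"
  proof (rule pointed_orbit_designI)
    fix g assume g: "g \<in> carrier G" "\<phi> g ` (E - ?C 0) = E - ?C 0"
    have sub: "proj_image g ` ?C 0 \<subseteq> E"
      using proj_image_ovoid[OF g(1)] C by blast
    have "E - (E - proj_image g ` ?C 0) = E - (E - ?C 0)"
      using g(2) unfolding phi_Diff[OF g(1) C] by (rule arg_cong)
    then have "proj_image g ` ?C 0 = ?C 0"
      unfolding double_diff[OF sub subset_refl] double_diff[OF C subset_refl] .
    then show "proj_image g pinf = pinf"
      by (rule stabilizer_fixes_pinf[where D = ?C, OF _ tau_circle g(1), rotated]) (rule circle)
  qed simp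
  show "\<phi> (m k ** s x y) ` (E - ?C 0) = E - ?C x" if k: "k \<noteq> 0" for k x y
    using phi_Diff[OF mult_carrier[OF m_carrier[OF k] s_carrier] C] circle[OF k, of x y 0] by simp
  show "inj (\<lambda>c. E - ?C c)"
  proof (rule injI)
    fix c d assume "E - ?C c = E - ?C d"
    then have "pt c 0 \<notin> E - ?C d" by (metis DiffD2 insertCI pt_in_cls)
    then show "c = d" by simp
  qed
  have "finite (cls 0)" by (simp add: cls_def)
  then have "card (?C 0) = ?q + 1" "finite (?C 0)"
    by (simp_all add: card_cls)
  then show "card (E - ?C 0) = ?q * (?q - 1)"
    using card_Diff_subset[OF _ C] card_ovoid
    by (simp add: power2_eq_square diff_mult_distrib2)
  have "?q * (?q - 1) - 1 = ?q^2 - ?q - 1"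
    by (simp add: power2_eq_square diff_mult_distrib2)
  then show "?q * (?q - 1) * (?q * (?q - 1) - 1) = ?q * ((?q - 1) * (?q^2 - ?q - 1))"
    by simp
  have off: "\<exists>a b. \<omega> = pt a b \<and> a \<noteq> 0" if "\<omega> \<in> E - ?C 0" for \<omega>
  proof -
    from that have "\<omega> \<in> E" by simp
    then show ?thesis using that by (cases rule: ovoid_cases) auto
  qed
  fix \<omega> \<omega>' assume "\<omega> \<in> E - ?C 0" "\<omega>' \<in> E - ?C 0"
  then obtain a b a' b' where "\<omega> = pt a b" "\<omega>' = pt a' b'" "a \<noteq> 0" "a' \<noteq> 0"
    using off by metis
  then show "\<exists>k y. k \<noteq> 0 \<and> \<phi> (m k ** s 0 y) \<omega> = \<omega>'"
    by (intro exI[of _ "a' / a"] exI[of _ "a' / a * \<theta> (a' / a) * b + b'"])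
      (simp add: phi_eq proj_image_small_cell del: theta_simps(6))
qed (simp add: power2_eq_square)

end

theorem theorem3:
  fixes n q :: nat
    and G :: "('f::{field,finite}^4^4) monoid"
    and \<P> :: "('f^4) set set"
    and \<B>\<^sub>2 \<B>\<^sub>3 :: "('f^4) set set set"
  assumes "n \<ge> 1"
    and "q = 2 ^ (2 * n + 1)"
    and "CARD('f) = q"
    and "G = Sz n"
    and "\<P> = ovoid n"
    and "\<B>\<^sub>2 = set_orbit n (Delta2 n)"
    and "\<B>\<^sub>3 = set_orbit n (Delta3 n)"
  shows "(two_design \<P> \<B>\<^sub>2 (q^2 + 1) q (q - 1) \<and>
         has_replication_number \<P> \<B>\<^sub>2 q (q^2)) \<and>
         (two_design \<P> \<B>\<^sub>3 (q^2 + 1) (q * (q - 1)) ((q - 1) * (q^2 - q - 1)) \<and>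
         has_replication_number \<P> \<B>\<^sub>3 (q * (q - 1)) (q^2 * (q - 1))) \<and>
         (\<forall>\<B>\<in>{\<B>\<^sub>2, \<B>\<^sub>3}.
           design_automorphism_group (opposite_group G) (ovoid_action n) \<P> \<B> \<and>
           flag_transitive (opposite_group G) (ovoid_action n) \<P> \<B> \<and>
           primitive_action (opposite_group G) \<P> (ovoid_action n) \<and>
           imprimitive_action (opposite_group G) \<B> (block_action (ovoid_action n) \<B>))"
proof -
  interpret suzuki_field n "TYPE('f)"
    by unfold_locales (use assms in simp)
  show ?thesis
    using Delta2_design Delta3_design assms(3-7) by simp
qed

end
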